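(* Fix $\nu$. Suppose the error assumptions (E1)–(E5) and (E7) and the regressor condition (R) hold, the coefficients decay geometrically, i.e. $\max_{\ell}\max_{\nu'}\|\mathbf c_j^{(\ell,\nu')}\|_\infty=O(\rho^j)$ for some $0\le\rho<1$, and $|x_{tj}\epsilon_t^{(\nu')}|\le1$ for all $t$, $j=1,\dots,p$ and $\nu'\ge1$. Then $\widehat{\boldsymbol\beta}_{T\nu}\to\boldsymbol\beta_\nu$ in probability as $T,p\to\infty$, provided $p\log(p)/T=o(1)$ and $\log^2(T)/\sqrt p=o(1)$.
   Context: Setting: $p=p_T$ may grow with $T$. Regressors $\mathbf x_t\in\mathbb R^p$, spatial locations $\mathbf s_t\in[0,1]^q$, responses $Y_t^{(\nu)}=\mathbf x_t^\top\boldsymbol\beta_\nu+\epsilon_t^{(\nu)}$, $\nu=1,\dots,d$, $t=1,\dots,T$. $\mathbb P$ is conditional on the regressors. $\mathbb X_T=(\mathbf x_1,\dots,\mathbf x_T)^\top$ full rank, $\widehat{\boldsymbol\beta}_{T\nu}=(\mathbb X_T^\top\mathbb X_T)^{-1}\mathbb X_T^\top(Y_1^{(\nu)},\dots,Y_T^{(\nu)})^\top$. (R): regressors bounded; there exist positive definite $\Sigma_{\mathbf x}$, $\eta\ge0$, $C<\infty$, compact interval $A\subset(0,\infty)$, independent of $T,p$, with $\|T^{-1}\sum_t\mathbf x_t\mathbf x_t^\top-\Sigma_{\mathbf x}\|_2\le Cp^\eta/\sqrt T$ and $\operatorname{spec}(T^{-1}\mathbb X_T^\top\mathbb X_T)\subset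 A$. Error model: $\boldsymbol\epsilon_t=\mathbf H(\mathbf U_t(\mathbf s_t),\dots,\mathbf U_{t-m}(\mathbf s_t))-\mathbb E\,\mathbf H(\mathbf U_t(\mathbf s_t),\dots,\mathbf U_{t-m}(\mathbf s_t))$, $m\in\mathbb N_0$ fixed, $\mathbf H=(H_1,\dots,H_d):\mathbb R^{d\times(m+1)}\to\mathbb R^d$; the $\nu$th coordinate of $\mathbf U_t(\mathbf s)$ is $\sum_{\ell=1}^L\phi_{\nu\ell}d(\mathbf s,\mathbf r_\ell)F_t^{(\ell,\nu)}+E_t^{(\nu)}$ with fixed $L$, real $\phi_{\nu\ell}$, sites $\mathbf r_\ell\in[0,1]^q$, a function $d:[0,1]^q\times[0,1]^q\to[0,1]$, $\mathbf F_t^{(\ell)}=\sum_{j\ge0}\mathbb C_j^{(\ell)}\boldsymbol\varepsilon_{t-j}^{(\ell)}$, $\mathbf E_t=\sum_{j\ge0}\mathbb C_j^{(0)}\boldsymbol\varepsilon_{t-j}^{(0)}$, $d\times d$ matrices $\mathbb C_j^{(\ell)}$ with rows $\mathbf c_j^{(\ell,\nu)\top}$; $\varepsilon_t^{(\ell,\nu)}$ is the $\nu$th coordinate of $\boldsymbol\varepsilon_t^{(\ell)}$. (E1) $\{\boldsymbol\varepsilon_t^{(\ell)}\}_t$, $\ell=0,\dots,L$, mutually independent sequences of independent mean zero vectors $\boldsymbol\varepsilon_t^{(\ell)}=\Sigma_{\varepsilon,t}^{(\ell)1/2}\mathbf u_t^{(\ell)}$, $\Sigma_{\varepsilon,t}^{(\ell)}$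 symmetric positive definite, $\mathbf u_t^{(\ell)}$ mean zero with independent coordinates. (E2) $\sup_t\max_\ell\max_\nu\mathbb E|\varepsilon_t^{(\ell,\nu)}|^{2+\delta}<\infty$ for some $\delta>0$. (E3) If $d=1$: $\sup_t\max_\ell\mathbb E(\varepsilon_t^{(\ell)})^2<\infty$. (E4) If $d=1$: $\mathbb E(\varepsilon_t^{(0)})^2\ge\underline\sigma_0^2>0$; if $d>1$: $\lambda_{\min}(\Sigma_{\varepsilon,t}^{(0)})\ge\underline\lambda>0$. (E5) $\varepsilon_t^{(\ell,\nu)}$ has density $p_t^{(\ell,\nu)}$ with $\sup_t\int|p_t^{(\ell,\nu)}(z+x)-p_t^{(\ell,\nu)}(z)|dz=O(|x|)$. (E7) each $H_\nu$ is $L_H$-Lipschitz w.r.t. the Frobenius norm, and some random $d\times(m+1)$ matrix $\Xi$ independent of $\{\mathbf U_t\}$ has $\sup_\nu\mathbb E|H_\nu(\Xi)|^{2+\delta}<\infty$. *)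

theory Defs
  imports "HOL-Probability.Probability" "Jordan_Normal_Form.Matrix" "Jordan_Normal_Form.DL_Rank"
    "Jordan_Normal_Form.Gauss_Jordan_Elimination" "Jordan_Normal_Form.Char_Poly"
begin

definition vnorm :: "real vec \<Rightarrow> real" where
  "vnorm v = sqrt (\<Sum>i<dim_vec v. (vec_index v i)^2)"

definition spec_norm :: "real mat \<Rightarrow> real" where
  "spec_norm A = Sup {vnorm (A *\<^sub>v v) | v. v \<in> carrier_vec (dim_col A) \<and> vnorm v \<le> 1}"

definition pos_def_mat :: "real mat \<Rightarrow> bool" where
  "pos_def_mat S \<longleftrightarrow> (\<exists>n. S \<in> carrier_mat n n \<and> transpose_mat S = S \<and>
      (\<forall>v \<in> carrier_vec n. v \<noteq> 0\<^sub>v n \<longrightarrow> v \<bullet> (S *\<^sub>v v) > 0))"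

definition ols :: "real mat \<Rightarrow> real vec \<Rightarrow> real vec" where
  "ols X Y = the (mat_inverse (transpose_mat X * X)) *\<^sub>v (transpose_mat X *\<^sub>v Y)"

definition pos_def :: "real^'n^'n \<Rightarrow> bool" where
  "pos_def S \<longleftrightarrow> transpose S = S \<and> (\<forall>v. v \<noteq> 0 \<longrightarrow> v \<bullet> (S *v v) > 0)"

definition mat_sqrt :: "real^'n^'n \<Rightarrow> real^'n^'n" where
  "mat_sqrt S = (THE R. pos_def R \<and> R ** R = S)"

definition lambda_min :: "real^'n^'n \<Rightarrow> real" where
  "lambda_min S = Inf {c. \<exists>v. v \<noteq> 0 \<and> S *v v = c *s v}"

definition lin_proc :: "(nat \<Rightarrow> real^'d^'d) \<Rightarrow> (int \<Rightarrow> 'a \<Rightarrow> real^'d) \<Rightarrow> int \<Rightarrow> 'a \<Rightarrow> real^'d" where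
  "lin_proc C e t \<omega> = (\<Sum>j. C j *v e (t - int j) \<omega>)"

definition U_field :: "nat \<Rightarrow> ('d::finite \<Rightarrow> nat \<Rightarrow> real) \<Rightarrow> (real^'q \<Rightarrow> real^'q \<Rightarrow> real) \<Rightarrow>
    (nat \<Rightarrow> real^'q) \<Rightarrow> (nat \<Rightarrow> nat \<Rightarrow> real^'d^'d) \<Rightarrow> (nat \<Rightarrow> int \<Rightarrow> 'a \<Rightarrow> real^'d) \<Rightarrow>
    int \<Rightarrow> real^'q \<Rightarrow> 'a \<Rightarrow> real^'d" where
  "U_field L \<phi> dd r C e t s \<omega> =
     (\<chi> \<nu>. (\<Sum>l\<in>{1..L}. \<phi> \<nu> l * dd s (r l) * (lin_proc (C l) (e l) t \<omega> $ \<nu>))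
            + lin_proc (C 0) (e 0) t \<omega> $ \<nu>)"

text \<open>eps_t = H(U_t(s_t),...,U_{t-m}(s_t)) - E H(...). The d x (m+1) argument matrix is
  represented as an element of real^'d^'k, its columns indexed by 'k, where lag :: 'k => nat
  is a bijection onto {0..m} (column k holds U_{t - lag k}(s_t)).\<close>
definition err_proc :: "'a measure \<Rightarrow> (real^'d^'k \<Rightarrow> real^'d) \<Rightarrow> ('k \<Rightarrow> nat) \<Rightarrow>
    (int \<Rightarrow> real^'q \<Rightarrow> 'a \<Rightarrow> real^'d) \<Rightarrow> (nat \<Rightarrow> real^'q) \<Rightarrow> nat \<Rightarrow> 'a \<Rightarrow> real^'d" where
  "err_proc M H lag U s t \<omega> =
     H (\<chi> k. U (int t - int (lag k)) (s t) \<omega>)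
     - integral\<^sup>L M (\<lambda>\<omega>'. H (\<chi> k. U (int t - int (lag k)) (s t) \<omega>'))"

end

theory Submission
  imports Defs
begin

text \<open>The estimation error is \<open>(X\<^sup>T X)\<^sup>-\<^sup>1 X\<^sup>T \<epsilon>\<close>, and the lower bound \<open>a\<close> on the spectrum of
  \<open>X\<^sup>T X / T\<close> gives \<open>\<parallel>error\<parallel> \<le> \<parallel>X\<^sup>T \<epsilon>\<parallel> / (a T)\<close>. A second-moment bound suffices: replacing all
  innovations up to time \<open>t'\<close> by zero changes the response at time \<open>t > t'\<close> by
  \<open>O(\<rho>\<^bsup>t - t'\<^esup>)\<close> in \<open>L\<^sup>2\<close> and makes it independent of \<open>\<epsilon>\<^bsub>t'\<^esub>\<close>, so the autocovariances of the
  errors decay geometrically. Hence \<open>E \<parallel>X\<^sup>T \<epsilon>\<parallel>\<^sup>2 = O(p T)\<close>, and Chebyshev's inequality bounds the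
  deviation probability by \<open>O(p / T)\<close>, which tends to zero.\<close>

section \<open>The least squares error\<close>

text \<open>One estimate does all the probabilistic work. Clipping at an earlier time controls
  covariances; clipping at the response's own time leaves a deterministic value, so the same
  estimate yields the variance bound and the integrability of the response. Two obstacles shape the
  argument. The series behind the linear processes converge only almost surely, and
  \<open>suminf\<close> is unspecified elsewhere, so the difference of two processes may be taken
  term by term only almost everywhere. Independence comes from disjoint blocks of innovations, so
  responses have to be read as functionals on a product space; hence they are polymorphic in the
  sample space. On the algebraic side the spectral condition speaks of eigenvalues only and must
  first become a lower bound for the quadratic form. That bound also makes the Gram matrix
  invertible, so that \<open>ols\<close> really applies an inverse. No constant depends on
  \<open>T\<close> or on the dimension, which is what makes the final bound a multiple of their
  ratio.\<close>

lemma vnorm_sq: "(vnorm v)\<^sup>2 = v \<bullet> v"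
  by (simp add: vnorm_def scalar_prod_def sum_nonneg power2_eq_square atLeast0LessThan)

lemma vnorm_nonneg: "0 \<le> vnorm v"
  by (simp add: vnorm_def sum_nonneg)

lemma scalar_prod_self_nonneg: "0 \<le> (v :: real vec) \<bullet> v"
  by (simp add: vnorm_sq[symmetric])

lemma scalar_prod_le_vnorm:
  assumes "v \<in> carrier_vec n" "w \<in> carrier_vec n"
  shows "v \<bullet> w \<le> vnorm v * vnorm w"
proof -
  have "(v \<bullet> w)\<^sup>2 \<le> (vnorm v)\<^sup>2 * (vnorm w)\<^sup>2"
    using Cauchy_Schwarz_ineq_sum[of "vec_index v" "vec_index w" "{0..<n}"] assms
    by (simp add: vnorm_sq scalar_prod_def flip: power2_eq_square)
  then have "(v \<bullet> w)\<^sup>2 \<le> (vnorm v * vnorm w)\<^sup>2"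
    by (simp add: power_mult_distrib)
  then show ?thesis
    by (rule power2_le_imp_le) (simp add: vnorm_nonneg)
qed

lemma smult_mat_mult_vec:
  fixes A :: "real mat"
  assumes "dim_vec v = dim_col A"
  shows "(k \<cdot>\<^sub>m A) *\<^sub>v v = k \<cdot>\<^sub>v (A *\<^sub>v v)"
  using assms by (auto intro!: eq_vecI)

section \<open>From the spectrum of a symmetric matrix to its quadratic form\<close>

lemma symmetric_scalar_prod:
  fixes A :: "real mat"
  assumes A: "A \<in> carrier_mat n n" "transpose_mat A = A"
    and "v \<in> carrier_vec n" "w \<in> carrier_vec n"
  shows "w \<bullet> (A *\<^sub>v v) = v \<bullet> (A *\<^sub>v w)"
  using transpose_vec_mult_scalar[OF A(1) assms(3,4)] A assms(3,4)
  by (metis comm_scalar_prod mult_mat_vec_carrier)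

text \<open>The form is nonnegative along the line \<open>v + x w\<close>, so a real quadratic
  polynomial in \<open>x\<close> has no negative value. The form may be degenerate, so a vanishing
  leading coefficient needs its own case.\<close>

lemma psd_Cauchy_Schwarz:
  fixes A :: "real mat"
  assumes A: "A \<in> carrier_mat n n" "transpose_mat A = A"
    and psd: "\<And>v. v \<in> carrier_vec n \<Longrightarrow> 0 \<le> v \<bullet> (A *\<^sub>v v)"
    and v: "v \<in> carrier_vec n" and w: "w \<in> carrier_vec n"
  shows "(v \<bullet> (A *\<^sub>v w))\<^sup>2 \<le> (v \<bullet> (A *\<^sub>v v)) * (w \<bullet> (A *\<^sub>v w))"
proof -
  let ?a = "v \<bullet> (A *\<^sub>v v)" and ?b = "v \<bullet> (A *\<^sub>v w)" and ?c = "w \<bullet> (A *\<^sub>v w)"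
  have q: "0 \<le> ?a + 2 * x * ?b + x\<^sup>2 * ?c" for x
  proof -
    have c: "x \<cdot>\<^sub>v w \<in> carrier_vec n" "A *\<^sub>v v \<in> carrier_vec n" "A *\<^sub>v w \<in> carrier_vec n"
      using A v w by auto
    have "(v + x \<cdot>\<^sub>v w) \<bullet> (A *\<^sub>v (v + x \<cdot>\<^sub>v w)) = ?a + x * ?b + (x * (w \<bullet> (A *\<^sub>v v)) + x * (x * ?c))"
      using A(1) v w c
      by (simp add: mult_add_distrib_mat_vec[of _ n n] mult_mat_vec add_scalar_prod_distrib[of _ n]
          scalar_prod_add_distrib[of _ n] distrib_left)
    also have "w \<bullet> (A *\<^sub>v v) = ?b"
      by (rule symmetric_scalar_prod[OF A v w])
    finally show ?thesis
      using psd[of "v + x \<cdot>\<^sub>v w"] v w by (simp add: power2_eq_square algebra_simps)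
  qed
  have "0 \<le> ?c" by (rule psd[OF w])
  show ?thesis
  proof (cases "?c = 0")
    case True
    have "?b = 0"
    proof (rule ccontr)
      assume b: "?b \<noteq> 0"
      \<comment> \<open>Without the quadratic term the polynomial is affine with slope
        \<open>2 * ?b\<close>; this \<open>x\<close> is where it takes the value -1.\<close>
      have "0 \<le> ?a + 2 * (-(?a + 1) / (2 * ?b)) * ?b" using q[of "-(?a + 1) / (2 * ?b)"] True by simp
      also have "\<dots> = -1" using b by (simp add: field_simps)
      finally show False by simp
    qed
    then show ?thesis using True by simp
  next
    case False
    with \<open>0 \<le> ?c\<close> have c: "?c > 0" by simp
    \<comment> \<open>The minimiser \<open>- ?b / ?c\<close> is inserted; multiplying by
      \<open>?c\<close> clears the denominator.\<close>
    have "0 \<le> (?a + 2 * (- ?b / ?c) * ?b + (- ?b / ?c)\<^sup>2 * ?c) * ?c"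
      using q[of "- ?b / ?c"] c by (intro mult_nonneg_nonneg) auto
    also have "\<dots> = ?a * ?c - ?b\<^sup>2"
      using c by (simp add: field_simps power2_eq_square)
    finally show ?thesis by simp
  qed
qed

lemma quadratic_form_bounded:
  fixes B :: "real mat"
  assumes B: "B \<in> carrier_mat n n"
  obtains K where "K > 0" "\<And>v. v \<in> carrier_vec n \<Longrightarrow> v \<bullet> (B *\<^sub>v v) \<le> K * (v \<bullet> v)"
proof -
  \<comment> \<open>Sum of the absolute entries; the extra 1 makes \<open>K\<close> strictly
    positive, so that \<open>1 / K\<close> can later serve as a coercivity constant.\<close>
  define K where "K = 1 + (\<Sum>i<n. \<Sum>j<n. \<bar>B $$ (i,j)\<bar>)"
  have "K > 0" unfolding K_def by (intro add_pos_nonneg sum_nonneg) auto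
  moreover have "v \<bullet> (B *\<^sub>v v) \<le> K * (v \<bullet> v)" if v: "v \<in> carrier_vec n" for v
  proof -
    have sq: "(vec_index v i)\<^sup>2 \<le> v \<bullet> v" if "i < n" for i
      using member_le_sum[of i "{0..<n}" "\<lambda>i. (vec_index v i)\<^sup>2"] v that
      by (simp add: scalar_prod_def power2_eq_square)
    have term_le: "vec_index v i * (B $$ (i,j) * vec_index v j) \<le> \<bar>B $$ (i,j)\<bar> * (v \<bullet> v)"
      if "i < n" "j < n" for i j
    proof -
      have "(\<bar>vec_index v i\<bar> - \<bar>vec_index v j\<bar>)\<^sup>2 \<ge> 0" by simp
      then have "\<bar>vec_index v i\<bar> * \<bar>vec_index v j\<bar> \<le> v \<bullet> v"
        using sq[OF that(1)] sq[OF that(2)] by (simp add: power2_diff)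
      then have "\<bar>B $$ (i,j)\<bar> * (\<bar>vec_index v i\<bar> * \<bar>vec_index v j\<bar>) \<le> \<bar>B $$ (i,j)\<bar> * (v \<bullet> v)"
        by (rule mult_left_mono) simp
      moreover have "vec_index v i * (B $$ (i,j) * vec_index v j)
          \<le> \<bar>B $$ (i,j)\<bar> * (\<bar>vec_index v i\<bar> * \<bar>vec_index v j\<bar>)"
        by (metis abs_ge_self abs_mult mult.left_commute)
      ultimately show ?thesis by linarith
    qed
    have "v \<bullet> (B *\<^sub>v v) = (\<Sum>i<n. \<Sum>j<n. vec_index v i * (B $$ (i,j) * vec_index v j))"
      using B v by (auto simp: scalar_prod_def sum_distrib_left atLeast0LessThan intro!: sum.cong)
    also have "\<dots> \<le> (\<Sum>i<n. \<Sum>j<n. \<bar>B $$ (i,j)\<bar> * (v \<bullet> v))"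
      by (intro sum_mono term_le) auto
    also have "\<dots> = (K - 1) * (v \<bullet> v)"
      unfolding K_def by (simp add: sum_distrib_right)
    also have "\<dots> \<le> K * (v \<bullet> v)"
      using scalar_prod_self_nonneg[of v] by (simp add: algebra_simps)
    finally show ?thesis .
  qed
  ultimately show ?thesis by (rule that)
qed

text \<open>Apply Cauchy-Schwarz for the form of \<open>A\<close> to \<open>v\<close> and
  \<open>w\<close>, the image of \<open>v\<close> under the inverse \<open>B\<close>. As
  \<open>A w = v\<close>, the left side is the square of \<open>v \<bullet> v\<close>, while the
  form at \<open>w\<close> is \<open>v \<bullet> (B *\<^sub>v v)\<close>, at most \<open>K\<close>
  times \<open>v \<bullet> v\<close>. Cancelling gives the constant \<open>1 / K\<close>.\<close>

lemma invertible_psd_coercive: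
  fixes A :: "real mat"
  assumes A: "A \<in> carrier_mat n n" "transpose_mat A = A"
    and psd: "\<And>v. v \<in> carrier_vec n \<Longrightarrow> 0 \<le> v \<bullet> (A *\<^sub>v v)"
    and det: "Determinant.det A \<noteq> 0"
  obtains k where "k > 0" "\<And>v. v \<in> carrier_vec n \<Longrightarrow> k * (v \<bullet> v) \<le> v \<bullet> (A *\<^sub>v v)"
proof -
  obtain B where B: "B \<in> carrier_mat n n" "A * B = 1\<^sub>m n"
    using mat_inverse(1)[OF A(1), where b = "()"] mat_inverse(2)[OF A(1)] det_non_zero_imp_unit[OF A(1) det, of "()"]
    by (cases "mat_inverse A") auto
  obtain K where K: "K > 0" "\<And>v. v \<in> carrier_vec n \<Longrightarrow> v \<bullet> (B *\<^sub>v v) \<le> K * (v \<bullet> v)"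
    using quadratic_form_bounded[OF B(1)] by blast
  have "(1 / K) * (v \<bullet> v) \<le> v \<bullet> (A *\<^sub>v v)" if v: "v \<in> carrier_vec n" for v
  proof (cases "v \<bullet> v = 0")
    case True
    then show ?thesis using psd[OF v] by simp
  next
    case False
    let ?w = "B *\<^sub>v v"
    have w: "?w \<in> carrier_vec n" using B v by auto
    have Aw: "A *\<^sub>v ?w = v"
      using A B v by (metis assoc_mult_mat_vec one_mult_mat_vec)
    have "(v \<bullet> v)\<^sup>2 \<le> (v \<bullet> (A *\<^sub>v v)) * (?w \<bullet> v)"
      using psd_Cauchy_Schwarz[OF A psd v w] by (simp add: Aw)
    also have "?w \<bullet> v = v \<bullet> ?w" by (rule comm_scalar_prod[OF w v])
    also have "(v \<bullet> (A *\<^sub>v v)) * (v \<bullet> ?w) \<le> (v \<bullet> (A *\<^sub>v v)) * (K * (v \<bullet> v))"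
      using K(2)[OF v] psd[OF v] by (rule mult_left_mono)
    finally have "(v \<bullet> v) * (v \<bullet> v) \<le> ((v \<bullet> (A *\<^sub>v v)) * K) * (v \<bullet> v)"
      by (simp add: power2_eq_square mult.assoc)
    moreover have "v \<bullet> v > 0" using False scalar_prod_self_nonneg[of v] by simp
    ultimately have "v \<bullet> v \<le> (v \<bullet> (A *\<^sub>v v)) * K" by simp
    then show ?thesis using K(1) by (simp add: field_simps)
  qed
  with K(1) show ?thesis by (intro that[of "1 / K"]) auto
qed

text \<open>A variational argument without compactness: if the largest \<open>c\<close> with \<open>G - c I\<close>
  positive semidefinite were not an eigenvalue, then \<open>G - c I\<close> would be invertible, hence
  coercive, and \<open>c\<close> could be enlarged.\<close>
lemma psd_eigenvalue_lower_bound: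
  fixes G :: "real mat"
  assumes G: "G \<in> carrier_mat n n" "transpose_mat G = G"
    and psd: "\<And>v. v \<in> carrier_vec n \<Longrightarrow> 0 \<le> v \<bullet> (G *\<^sub>v v)"
    and eig: "\<And>c. eigenvalue G c \<Longrightarrow> a \<le> c"
    and v: "v \<in> carrier_vec n"
  shows "a * (v \<bullet> v) \<le> v \<bullet> (G *\<^sub>v v)"
proof (cases "n = 0")
  case True
  then show ?thesis using v G by (simp add: scalar_prod_def)
next
  case False
  define S where "S = {c. \<forall>v\<in>carrier_vec n. c * (v \<bullet> v) \<le> v \<bullet> (G *\<^sub>v v)}"
  define c where "c = Sup S"
  have "0 \<in> S" using psd by (simp add: S_def)
  have ne: "S \<noteq> {}" using \<open>0 \<in> S\<close> by auto
  have upper: "x * (w \<bullet> w) \<le> w \<bullet> (G *\<^sub>v w)" if "x \<in> S" "w \<in> carrier_vec n" for x w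
    using that by (auto simp: S_def)
  \<comment> \<open>Positive dimension matters here: in dimension zero every real lies in
    \<open>S\<close>, while otherwise the form at a unit vector bounds it.\<close>
  have bdd: "bdd_above S"
  proof
    fix x assume "x \<in> S"
    from upper[OF this unit_vec_carrier[of n 0]] False
    show "x \<le> unit_vec n 0 \<bullet> (G *\<^sub>v unit_vec n 0)" by simp
  qed
  have "c \<in> S"
  proof -
    have "c * (w \<bullet> w) \<le> w \<bullet> (G *\<^sub>v w)" if w: "w \<in> carrier_vec n" for w
    proof (cases "w \<bullet> w = 0")
      case True
      then show ?thesis using psd[OF w] by simp
    next
      case False
      then have pos: "w \<bullet> w > 0" using scalar_prod_self_nonneg[of w] by simp
      have "c \<le> (w \<bullet> (G *\<^sub>v w)) / (w \<bullet> w)"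
        unfolding c_def using ne upper[OF _ w] pos by (intro cSup_least) (auto simp: field_simps)
      then show ?thesis using pos by (simp add: field_simps)
    qed
    then show ?thesis by (simp add: S_def)
  qed
  have "a \<le> c"
  proof (rule ccontr)
    assume "\<not> a \<le> c"
    then have "\<not> eigenvalue G c" using eig by auto
    then have det: "Determinant.det (char_matrix G c) \<noteq> 0" by (simp add: eigenvalue_det[OF G(1)])
    have A: "char_matrix G c \<in> carrier_mat n n" using G by simp
    have sym: "transpose_mat (char_matrix G c) = char_matrix G c"
    proof -
      have "G $$ (j, i) = G $$ (i, j)" if "i < n" "j < n" for i j
        using G that by (metis carrier_matD index_transpose_mat(1))
      then show ?thesis using G(1) by (auto simp: char_matrix_def intro!: eq_matI)
    qed
    have form: "w \<bullet> (char_matrix G c *\<^sub>v w) = w \<bullet> (G *\<^sub>v w) - c * (w \<bullet> w)"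
      if w: "w \<in> carrier_vec n" for w
    proof -
      have "char_matrix G c *\<^sub>v w = G *\<^sub>v w + (-c) \<cdot>\<^sub>v w"
        using G(1) w by (simp add: char_matrix_def add_mult_distrib_mat_vec[of _ n n] smult_mat_mult_vec)
      then show ?thesis
        using G(1) w by (simp add: scalar_prod_add_distrib[of _ n])
    qed
    obtain k where k: "k > 0"
      "\<And>w. w \<in> carrier_vec n \<Longrightarrow> k * (w \<bullet> w) \<le> w \<bullet> (char_matrix G c *\<^sub>v w)"
      using invertible_psd_coercive[OF A sym _ det] upper[OF \<open>c \<in> S\<close>] form by (metis diff_ge_0_iff_ge)
    have "c + k \<in> S"
      using k(2) form by (fastforce simp: S_def algebra_simps)
    then have "c + k \<le> c" unfolding c_def using bdd by (rule cSup_upper)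
    with k(1) show False by simp
  qed
  then have "a * (v \<bullet> v) \<le> c * (v \<bullet> v)"
    using scalar_prod_self_nonneg by (rule mult_right_mono)
  also have "\<dots> \<le> v \<bullet> (G *\<^sub>v v)" by (rule upper[OF \<open>c \<in> S\<close> v])
  finally show ?thesis .
qed

text \<open>The error \<open>d\<close> solves the normal equation \<open>G d = y\<close> with
  \<open>y\<close> the transposed design applied to \<open>w\<close>. Testing it against
  \<open>d\<close> bounds \<open>T a\<close> times the squared norm of \<open>d\<close> by
  \<open>d \<bullet> y\<close>; Cauchy-Schwarz and cancelling one norm finish, with no estimate of
  the inverse itself.\<close>

lemma ols_error_bound:
  fixes X :: "real mat"
  assumes X: "X \<in> carrier_mat T n" and b: "b \<in> carrier_vec n" and w: "w \<in> carrier_vec T"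
    and T: "T \<ge> 1" and a: "a > 0"
    and eig: "\<And>c. eigenvalue (smult_mat (1 / real T) (transpose_mat X * X)) c \<Longrightarrow> a \<le> c"
  shows "real T * a * vnorm (ols X (X *\<^sub>v b + w) - b) \<le> vnorm (transpose_mat X *\<^sub>v w)"
proof -
  let ?G = "transpose_mat X * X"
  let ?N = "smult_mat (1 / real T) ?G"
  have G: "?G \<in> carrier_mat n n" and N: "?N \<in> carrier_mat n n" using X by auto
  have Gv: "v \<bullet> (?G *\<^sub>v v) = (X *\<^sub>v v) \<bullet> (X *\<^sub>v v)" if v: "v \<in> carrier_vec n" for v
  proof -
    have Xv: "X *\<^sub>v v \<in> carrier_vec T" using X v by auto
    have "v \<bullet> (?G *\<^sub>v v) = (transpose_mat X *\<^sub>v (X *\<^sub>v v)) \<bullet> v"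
      using X v Xv by (subst comm_scalar_prod[of _ n]) (auto simp: assoc_mult_mat_vec[of _ n T _ n])
    also have "\<dots> = (X *\<^sub>v v) \<bullet> (X *\<^sub>v v)" by (rule transpose_vec_mult_scalar[OF X v Xv])
    finally show ?thesis .
  qed
  have Nv: "?N *\<^sub>v v = (1 / real T) \<cdot>\<^sub>v (?G *\<^sub>v v)" if v: "v \<in> carrier_vec n" for v
    using X v by (intro smult_mat_mult_vec) auto
  have psd: "0 \<le> v \<bullet> (?N *\<^sub>v v)" if v: "v \<in> carrier_vec n" for v
    using G v Gv[OF v] scalar_prod_self_nonneg[of "X *\<^sub>v v"] by (simp add: Nv[OF v])
  have sym: "transpose_mat ?N = ?N"
    using X by (auto simp: intro!: eq_matI comm_scalar_prod[of _ T])
  have low: "real T * a * (v \<bullet> v) \<le> v \<bullet> (?G *\<^sub>v v)" if v: "v \<in> carrier_vec n" for v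
  proof -
    have "a * (v \<bullet> v) \<le> v \<bullet> (?N *\<^sub>v v)"
      by (rule psd_eigenvalue_lower_bound[OF N sym psd eig v])
    also have "\<dots> = (v \<bullet> (?G *\<^sub>v v)) / real T"
      using G v by (simp add: Nv[OF v])
    finally show ?thesis using T by (simp add: field_simps)
  qed
  \<comment> \<open>A nonzero kernel vector would contradict the lower bound on the form. This is
    what gives \<open>the (mat_inverse ...)\<close> in \<open>ols\<close> its meaning.\<close>
  have det: "Determinant.det ?G \<noteq> 0"
  proof
    assume "Determinant.det ?G = 0"
    then obtain v where v: "v \<in> carrier_vec n" "v \<noteq> 0\<^sub>v n" "?G *\<^sub>v v = 0\<^sub>v n"
      using det_0_iff_vec_prod_zero[OF G] by auto
    have "real T * a * (v \<bullet> v) \<le> 0" using low[OF v(1)] v by simp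
    moreover have "v \<bullet> v > 0"
    proof -
      obtain i where i: "i < n" "vec_index v i \<noteq> 0" using v by (metis carrier_vecD eq_vecI index_zero_vec)
      have "(vec_index v i)\<^sup>2 \<le> v \<bullet> v"
        using member_le_sum[of i "{0..<n}" "\<lambda>i. (vec_index v i)\<^sup>2"] v i
        by (simp add: scalar_prod_def power2_eq_square)
      moreover have "(vec_index v i)\<^sup>2 > 0" using i by simp
      ultimately show ?thesis by linarith
    qed
    ultimately show False using T a by (simp add: mult_le_0_iff)
  qed
  obtain B where B: "mat_inverse ?G = Some B" "B \<in> carrier_mat n n" "?G * B = 1\<^sub>m n" "B * ?G = 1\<^sub>m n"
    using mat_inverse(1)[OF G, where b = "()"] mat_inverse(2)[OF G] det_non_zero_imp_unit[OF G det, of "()"]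
    by (cases "mat_inverse ?G") auto
  let ?y = "transpose_mat X *\<^sub>v w"
  have y: "?y \<in> carrier_vec n" using X w by auto
  let ?d = "ols X (X *\<^sub>v b + w) - b"
  have Xb: "X *\<^sub>v b \<in> carrier_vec T" using X b by auto
  have "transpose_mat X *\<^sub>v (X *\<^sub>v b + w) = ?G *\<^sub>v b + ?y"
    using X b w Xb by (simp add: mult_add_distrib_mat_vec[of _ n T] assoc_mult_mat_vec[of _ n T _ n])
  then have "ols X (X *\<^sub>v b + w) = B *\<^sub>v (?G *\<^sub>v b) + B *\<^sub>v ?y"
    using B G b y by (simp add: ols_def mult_add_distrib_mat_vec[of _ n n])
  also have "B *\<^sub>v (?G *\<^sub>v b) = b"
    using B G b by (metis assoc_mult_mat_vec one_mult_mat_vec)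
  finally have d: "?d = B *\<^sub>v ?y" using B b y by auto
  have dc: "?d \<in> carrier_vec n" unfolding d using B y by auto
  have Gd: "?G *\<^sub>v ?d = ?y"
    unfolding d using B G y by (metis assoc_mult_mat_vec one_mult_mat_vec)
  have "real T * a * (vnorm ?d)\<^sup>2 \<le> ?d \<bullet> ?y"
    using low[OF dc] Gd by (simp add: vnorm_sq)
  also have "\<dots> \<le> vnorm ?d * vnorm ?y" by (rule scalar_prod_le_vnorm[OF dc y])
  finally have *: "(real T * a * vnorm ?d) * vnorm ?d \<le> vnorm ?y * vnorm ?d"
    by (simp add: power2_eq_square mult_ac)
  show ?thesis
  proof (cases "vnorm ?d = 0")
    case True
    then show ?thesis by (simp add: vnorm_nonneg)
  next
    case False
    then have "vnorm ?d > 0" using vnorm_nonneg[of ?d] by linarith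
    with * show ?thesis by simp
  qed
qed

section \<open>Square-integrable linear processes\<close>

text \<open>Splitting each weight as \<open>sqrt (k j) * sqrt (k j)\<close> keeps the weight on the
  squares. The result is used pathwise and stands in for Minkowski's inequality for infinite
  series.\<close>

lemma suminf_weighted_Cauchy_Schwarz:
  fixes k z :: "nat \<Rightarrow> real"
  assumes k: "\<And>j. 0 \<le> k j" "summable k"
    and z: "summable (\<lambda>j. k j * (z j)\<^sup>2)"
  shows "summable (\<lambda>j. k j * z j)"
    and "(\<Sum>j. k j * z j)\<^sup>2 \<le> (\<Sum>j. k j) * (\<Sum>j. k j * (z j)\<^sup>2)"
proof -
  have le: "\<bar>z j\<bar> \<le> 1 + (z j)\<^sup>2" for j
  proof -
    have "0 \<le> (\<bar>z j\<bar> - 1 / 2)\<^sup>2" by simp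
    then show ?thesis by (simp add: power2_diff power_divide)
  qed
  have "norm (k j * z j) \<le> k j + k j * (z j)\<^sup>2" for j
    using mult_left_mono[OF le[of j] k(1)[of j]] k(1)[of j] by (simp add: abs_mult algebra_simps)
  then show s: "summable (\<lambda>j. k j * z j)"
    using summable_add[OF k(2) z] by (intro summable_comparison_test[of "\<lambda>j. k j * z j"]) auto
  have "(\<lambda>n. (\<Sum>j<n. k j * z j)\<^sup>2) \<longlonglongrightarrow> (\<Sum>j. k j * z j)\<^sup>2"
    by (intro tendsto_power summable_LIMSEQ s)
  moreover have "(\<Sum>j<n. k j * z j)\<^sup>2 \<le> (\<Sum>j. k j) * (\<Sum>j. k j * (z j)\<^sup>2)" for n
  proof -
    have "(\<Sum>j<n. k j * z j)\<^sup>2 = (\<Sum>j<n. sqrt (k j) * (sqrt (k j) * z j))\<^sup>2"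
      by (simp flip: mult.assoc add: k)
    also have "\<dots> \<le> (\<Sum>j<n. (sqrt (k j))\<^sup>2) * (\<Sum>j<n. (sqrt (k j) * z j)\<^sup>2)"
      by (rule Cauchy_Schwarz_ineq_sum)
    also have "\<dots> = (\<Sum>j<n. k j) * (\<Sum>j<n. k j * (z j)\<^sup>2)"
      by (simp add: power_mult_distrib k)
    also have "\<dots> \<le> (\<Sum>j. k j) * (\<Sum>j. k j * (z j)\<^sup>2)"
      using k z by (intro mult_mono sum_le_suminf suminf_nonneg) (auto intro!: sum_nonneg)
    finally show ?thesis .
  qed
  ultimately show "(\<Sum>j. k j * z j)\<^sup>2 \<le> (\<Sum>j. k j) * (\<Sum>j. k j * (z j)\<^sup>2)"
    by (intro LIMSEQ_le_const2) auto
qed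

text \<open>The weighted sum of the squared \<open>Z j\<close> has expectation at most the total
  weight times \<open>K\<close>, hence is finite almost everywhere. Wherever it is finite, the
  series converges absolutely and its squared norm is at most the total weight times this sum;
  integrating brings in the second factor of the total weight.\<close>

lemma L2_series:
  fixes Y :: "nat \<Rightarrow> 'a \<Rightarrow> 'b::{banach, second_countable_topology}"
    and Z :: "nat \<Rightarrow> 'a \<Rightarrow> real" and k :: "nat \<Rightarrow> real"
  assumes [measurable]: "\<And>j. Z j \<in> borel_measurable M"
    and Y: "\<And>j \<omega>. norm (Y j \<omega>) \<le> k j * Z j \<omega>"
    and k: "\<And>j. 0 \<le> k j" "summable k"
    and Z: "\<And>j. (\<integral>\<^sup>+\<omega>. ennreal ((Z j \<omega>)\<^sup>2) \<partial>M) \<le> ennreal K" and K: "0 \<le> K"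
  shows "AE \<omega> in M. summable (\<lambda>j. Y j \<omega>)"
    and "(\<integral>\<^sup>+\<omega>. ennreal ((norm (\<Sum>j. Y j \<omega>))\<^sup>2) \<partial>M) \<le> ennreal ((\<Sum>j. k j)\<^sup>2 * K)"
proof -
  let ?k = "\<Sum>j. k j"
  have k0: "0 \<le> ?k" using k by (simp add: suminf_nonneg)
  define S where "S \<omega> = (\<Sum>j. ennreal (k j * (Z j \<omega>)\<^sup>2))" for \<omega>
  have [measurable]: "S \<in> borel_measurable M" unfolding S_def by measurable
  have "(\<integral>\<^sup>+\<omega>. S \<omega> \<partial>M) = (\<Sum>j. \<integral>\<^sup>+\<omega>. ennreal (k j * (Z j \<omega>)\<^sup>2) \<partial>M)"
    unfolding S_def by (intro nn_integral_suminf) measurable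
  also have "\<dots> = (\<Sum>j. ennreal (k j) * (\<integral>\<^sup>+\<omega>. ennreal ((Z j \<omega>)\<^sup>2) \<partial>M))"
    by (simp add: ennreal_mult k nn_integral_cmult)
  also have "\<dots> \<le> (\<Sum>j. ennreal (k j) * ennreal K)"
    by (intro suminf_le mult_left_mono Z) auto
  also have "\<dots> = (\<Sum>j. ennreal (k j * K))"
    by (simp add: ennreal_mult k K)
  also have "\<dots> = ennreal (\<Sum>j. k j * K)"
    using k K by (intro suminf_ennreal2) (auto intro: summable_mult2)
  also have "\<dots> = ennreal (?k * K)"
    using k by (simp add: suminf_mult2)
  finally have S: "(\<integral>\<^sup>+\<omega>. S \<omega> \<partial>M) \<le> ennreal (?k * K)" .
  then have "(\<integral>\<^sup>+\<omega>. S \<omega> \<partial>M) \<noteq> \<infinity>" by (auto simp: top_unique)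
  then have fin: "AE \<omega> in M. S \<omega> \<noteq> \<infinity>" by (intro nn_integral_PInf_AE) auto
  have main: "summable (\<lambda>j. Y j \<omega>) \<and> ennreal ((norm (\<Sum>j. Y j \<omega>))\<^sup>2) \<le> ennreal ?k * S \<omega>"
    if "S \<omega> \<noteq> \<infinity>" for \<omega>
  proof -
    have sz: "summable (\<lambda>j. k j * (Z j \<omega>)\<^sup>2)"
      using that k unfolding S_def by (intro summable_suminf_not_top) auto
    note cs = suminf_weighted_Cauchy_Schwarz[OF k sz]
    have sn: "summable (\<lambda>j. norm (Y j \<omega>))"
      using Y by (intro summable_comparison_test[OF _ cs(1)]) auto
    have "norm (\<Sum>j. Y j \<omega>) \<le> (\<Sum>j. norm (Y j \<omega>))" by (rule summable_norm[OF sn])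
    also have "\<dots> \<le> (\<Sum>j. k j * Z j \<omega>)" by (rule suminf_le[OF Y sn cs(1)])
    finally have "(norm (\<Sum>j. Y j \<omega>))\<^sup>2 \<le> (\<Sum>j. k j * Z j \<omega>)\<^sup>2"
      by (intro power_mono) auto
    also note cs(2)
    finally have "ennreal ((norm (\<Sum>j. Y j \<omega>))\<^sup>2) \<le> ennreal (?k * (\<Sum>j. k j * (Z j \<omega>)\<^sup>2))"
      by (rule ennreal_leI)
    also have "\<dots> = ennreal ?k * S \<omega>"
      unfolding S_def using k sz k0 
      by (subst suminf_ennreal2) (auto simp: ennreal_mult suminf_nonneg)
    finally show ?thesis using summable_norm_cancel[OF sn] by blast
  qed
  show "AE \<omega> in M. summable (\<lambda>j. Y j \<omega>)"
    using fin by eventually_elim (use main in blast)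
  have "(\<integral>\<^sup>+\<omega>. ennreal ((norm (\<Sum>j. Y j \<omega>))\<^sup>2) \<partial>M) \<le> (\<integral>\<^sup>+\<omega>. ennreal ?k * S \<omega> \<partial>M)"
    by (rule nn_integral_mono_AE, use fin in eventually_elim) (use main in blast)
  also have "\<dots> = ennreal ?k * (\<integral>\<^sup>+\<omega>. S \<omega> \<partial>M)"
    by (rule nn_integral_cmult) measurable
  also have "\<dots> \<le> ennreal ?k * ennreal (?k * K)"
    using S by (rule mult_left_mono) simp
  also have "\<dots> = ennreal (?k\<^sup>2 * K)"
    using k0 K by (simp add: ennreal_mult[symmetric] power2_eq_square mult.assoc)
  finally show "(\<integral>\<^sup>+\<omega>. ennreal ((norm (\<Sum>j. Y j \<omega>))\<^sup>2) \<partial>M) \<le> ennreal (?k\<^sup>2 * K)" .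
qed

text \<open>The root of the dimension turns the maximum norm of a row into its Euclidean norm; the
  full factor comes from bounding the norm of the image by the sum over its components.\<close>

lemma norm_matrix_vector_mult_le:
  fixes A :: "real^'d^'d"
  assumes "\<And>i. infnorm (A $ i) \<le> b"
  shows "norm (A *v x) \<le> (real CARD('d) * sqrt (real CARD('d)) * b) * norm x"
proof -
  have row: "norm (A $ i) \<le> sqrt (real CARD('d)) * b" for i
    using order_trans[OF norm_le_infnorm[of "A $ i"]
        mult_left_mono[OF assms[of i], of "sqrt (real DIM(real^'d))"]] by simp
  have "norm (A *v x) \<le> (\<Sum>i\<in>UNIV. \<bar>vec_nth (A *v x) i\<bar>)" by (rule norm_le_l1_cart)
  also have "\<dots> \<le> (\<Sum>i\<in>(UNIV::'d set). sqrt (real CARD('d)) * b * norm x)"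
  proof (rule sum_mono)
    fix i
    have "\<bar>vec_nth (A *v x) i\<bar> = \<bar>inner (A $ i) x\<bar>"
      by (simp add: matrix_vector_mul_component)
    also have "\<dots> \<le> norm (A $ i) * norm x" by (rule Cauchy_Schwarz_ineq2)
    also have "\<dots> \<le> sqrt (real CARD('d)) * b * norm x" by (intro mult_right_mono row) auto
    finally show "\<bar>vec_nth (A *v x) i\<bar> \<le> sqrt (real CARD('d)) * b * norm x" .
  qed
  finally show ?thesis by simp
qed

lemma lin_proc_measurable [measurable (raw)]:
  assumes [measurable]: "\<And>\<tau>. e \<tau> \<in> borel_measurable M"
  shows "lin_proc C e t \<in> borel_measurable M"
proof -
  have [measurable]: "(\<lambda>x. (C j *v x)) \<in> borel_measurable borel" for j
    by (intro borel_measurable_continuous_onI linear_continuous_on matrix_vector_mul_bounded_linear)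
  show ?thesis unfolding lin_proc_def by measurable
qed

text \<open>The first \<open>h\<close> lags cancel, so only the geometric tail remains, with total
  weight \<open>b * \<rho> ^ h / (1 - \<rho>)\<close>. The two domination conditions hold as soon as
  each \<open>e'\<close> is either \<open>e\<close> or zero.\<close>

lemma lin_proc_diff_L2:
  fixes C :: "nat \<Rightarrow> real^'d^'d" and e e' :: "int \<Rightarrow> 'a \<Rightarrow> real^'d"
  assumes [measurable]: "\<And>\<tau>. e \<tau> \<in> borel_measurable M" "\<And>\<tau>. e' \<tau> \<in> borel_measurable M"
    and C: "\<And>j x. norm (C j *v x) \<le> b * \<rho> ^ j * norm x" and b: "0 \<le> b"
    and \<rho>: "0 \<le> \<rho>" "\<rho> < 1"
    and e: "\<And>\<tau>. (\<integral>\<^sup>+\<omega>. ennreal ((norm (e \<tau> \<omega>))\<^sup>2) \<partial>M) \<le> ennreal K" and K: "0 \<le> K"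
    and e'_le: "\<And>\<tau> \<omega>. norm (e' \<tau> \<omega>) \<le> norm (e \<tau> \<omega>)"
    and diff_le: "\<And>\<tau> \<omega>. norm (e \<tau> \<omega> - e' \<tau> \<omega>) \<le> norm (e \<tau> \<omega>)"
    and agree: "\<And>j \<omega>. j < h \<Longrightarrow> e' (t - int j) \<omega> = e (t - int j) \<omega>"
  shows "(\<integral>\<^sup>+\<omega>. ennreal ((norm (lin_proc C e t \<omega> - lin_proc C e' t \<omega>))\<^sup>2) \<partial>M)
    \<le> ennreal ((b * \<rho> ^ h / (1 - \<rho>))\<^sup>2 * K)"
proof -
  let ?Z = "\<lambda>j \<omega>. norm (e (t - int j) \<omega>)"
  have sum_k: "summable (\<lambda>j. b * \<rho> ^ j)" using \<rho> by (intro summable_mult summable_geometric) auto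
  \<comment> \<open>Zero weights on the cancelling lags allow the series bound to be applied to the
    tail without reindexing.\<close>
  define k where "k j = (if j < h then 0 else b * \<rho> ^ j)" for j
  have k: "0 \<le> k j" "summable k" for j
    using b \<rho> by (auto simp: k_def intro!: summable_comparison_test[OF _ sum_k])
  have "k sums (b * \<rho> ^ h / (1 - \<rho>))"
  proof -
    have "(\<lambda>i. b * \<rho> ^ h * \<rho> ^ i) sums (b * \<rho> ^ h * (1 / (1 - \<rho>)))"
      using \<rho> by (intro sums_mult geometric_sums) auto
    then have "(\<lambda>i. k (i + h)) sums (b * \<rho> ^ h / (1 - \<rho>))"
      by (simp add: k_def power_add mult_ac)
    moreover have "(\<Sum>i<h. k i) = 0" by (simp add: k_def)
    ultimately show ?thesis using sums_iff_shift[of k h] by simp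
  qed
  then have kS: "(\<Sum>j. k j) = b * \<rho> ^ h / (1 - \<rho>)" by (rule sums_unique[symmetric])
  have CZ: "norm (C j *v x) \<le> b * \<rho> ^ j * norm (e (t - int j) \<omega>)" if "norm x \<le> norm (e (t - int j) \<omega>)" for x j \<omega>
    using C[of j x] mult_left_mono[OF that, of "b * \<rho> ^ j"] b \<rho> by simp
  have Zm: "(\<integral>\<^sup>+\<omega>. ennreal ((?Z j \<omega>)\<^sup>2) \<partial>M) \<le> ennreal K" for j by (rule e)
  have bk: "0 \<le> b * \<rho> ^ j" for j using b \<rho> by simp
  have s1: "AE \<omega> in M. summable (\<lambda>j. C j *v e (t - int j) \<omega>)"
    by (rule L2_series(1)[where Z = ?Z and K = K, OF _ _ bk sum_k Zm K]) (auto intro!: CZ)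
  have s2: "AE \<omega> in M. summable (\<lambda>j. C j *v e' (t - int j) \<omega>)"
    by (rule L2_series(1)[where Z = ?Z and K = K, OF _ _ bk sum_k Zm K]) (auto intro!: CZ e'_le)
  let ?D = "\<lambda>j \<omega>. C j *v (e (t - int j) \<omega> - e' (t - int j) \<omega>)"
  have D: "norm (?D j \<omega>) \<le> k j * ?Z j \<omega>" for j \<omega>
    using agree CZ[OF diff_le] by (auto simp: k_def)
  \<comment> \<open>Both series must converge before they can be subtracted term by term, hence the
    separate summability facts above.\<close>
  have "AE \<omega> in M. lin_proc C e t \<omega> - lin_proc C e' t \<omega> = (\<Sum>j. ?D j \<omega>)"
    using s1 s2 by eventually_elim (simp add: lin_proc_def suminf_diff matrix_vector_mult_diff_distrib)
  then have "(\<integral>\<^sup>+\<omega>. ennreal ((norm (lin_proc C e t \<omega> - lin_proc C e' t \<omega>))\<^sup>2) \<partial>M)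
    = (\<integral>\<^sup>+\<omega>. ennreal ((norm (\<Sum>j. ?D j \<omega>))\<^sup>2) \<partial>M)"
    by (intro nn_integral_cong_AE) auto
  also have "\<dots> \<le> ennreal ((\<Sum>j. k j)\<^sup>2 * K)"
    by (rule L2_series(2)[where Z = ?Z, OF _ D k Zm K]) auto
  finally show ?thesis by (simp add: kS)
qed

section \<open>Measurability, causality and Lipschitz dependence of the spatial field\<close>

lemma borel_measurable_vec_lambda:
  fixes f :: "'n::finite \<Rightarrow> 'a \<Rightarrow> 'b::euclidean_space"
  assumes "\<And>i. f i \<in> borel_measurable M"
  shows "(\<lambda>\<omega>. \<chi> i. f i \<omega>) \<in> borel_measurable M"
  using assms by (subst borel_measurable_euclidean_space) (auto simp: Basis_vec_def inner_axis)

lemma U_field_measurable [measurable (raw)]: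
  assumes "\<And>l \<tau>. l \<le> L \<Longrightarrow> e l \<tau> \<in> borel_measurable M"
  shows "U_field L \<phi> dd r C e t x \<in> borel_measurable M"
proof -
  have lm: "lin_proc (C l) (e l) \<tau> \<in> borel_measurable M" if "l \<le> L" for l \<tau>
    using that assms by (intro lin_proc_measurable) auto
  have [measurable]: "(\<lambda>v :: real^'c. vec_nth v i) \<in> borel_measurable borel" for i :: 'c
    by (intro borel_measurable_continuous_onI continuous_intros)
  have comp: "(\<lambda>\<omega>. vec_nth (lin_proc (C l) (e l) \<tau> \<omega>) i) \<in> borel_measurable M" if "l \<le> L" for l \<tau> i
    using measurable_compose[OF lm[OF that, of \<tau>], of "\<lambda>v. vec_nth v i" borel] by simp
  show ?thesis
    unfolding U_field_def
    by (intro borel_measurable_vec_lambda borel_measurable_add borel_measurable_sum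
        borel_measurable_times borel_measurable_const comp) auto
qed

text \<open>Causality: only innovations up to time \<open>t\<close> are read. The two sample points
  may live in different spaces, which permits passing to a product space of innovations.\<close>

lemma U_field_cong:
  assumes "\<And>l \<tau>. l \<le> L \<Longrightarrow> \<tau> \<le> t \<Longrightarrow> e l \<tau> \<omega> = e' l \<tau> \<omega>'"
  shows "U_field L \<phi> dd r C e t x \<omega> = U_field L \<phi> dd r C e' t x \<omega>'"
  using assms by (simp add: U_field_def lin_proc_def)

text \<open>In the constant, each factor loading enters with its absolute value because the distance
  weights are at most 1, and the summand 1 accounts for the idiosyncratic process with index
  0.\<close>

lemma norm_U_field_diff_le:
  fixes \<phi> :: "'d::finite \<Rightarrow> nat \<Rightarrow> real"
  assumes dd: "\<And>l. l \<in> {1..L} \<Longrightarrow> \<bar>dd x (r l)\<bar> \<le> 1"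
  shows "norm (U_field L \<phi> dd r C e t x \<omega> - U_field L \<phi> dd r C e' t x \<omega>)
    \<le> (\<Sum>i\<in>UNIV. 1 + (\<Sum>l\<in>{1..L}. \<bar>\<phi> i l\<bar>))
      * (\<Sum>l\<le>L. norm (lin_proc (C l) (e l) t \<omega> - lin_proc (C l) (e' l) t \<omega>))"
proof -
  define D where "D l = lin_proc (C l) (e l) t \<omega> - lin_proc (C l) (e' l) t \<omega>" for l
  define S where "S = (\<Sum>l\<le>L. norm (D l))"
  let ?U = "U_field L \<phi> dd r C e t x \<omega> - U_field L \<phi> dd r C e' t x \<omega>"
  have D_le: "norm (D l) \<le> S" if "l \<le> L" for l
    unfolding S_def by (rule member_le_sum) (use that in auto)
  have "norm ?U \<le> (\<Sum>i\<in>UNIV. \<bar>vec_nth ?U i\<bar>)" by (rule norm_le_l1_cart)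
  also have "\<dots> \<le> (\<Sum>i\<in>UNIV. (1 + (\<Sum>l\<in>{1..L}. \<bar>\<phi> i l\<bar>)) * S)"
  proof (rule sum_mono)
    fix i
    have "vec_nth ?U i = (\<Sum>l\<in>{1..L}. \<phi> i l * dd x (r l) * vec_nth (D l) i) + vec_nth (D 0) i"
      by (simp add: U_field_def D_def right_diff_distrib sum_subtractf)
    also have "\<bar>\<dots>\<bar> \<le> (\<Sum>l\<in>{1..L}. \<bar>\<phi> i l * dd x (r l) * vec_nth (D l) i\<bar>) + \<bar>vec_nth (D 0) i\<bar>"
      by (intro order_trans[OF abs_triangle_ineq] add_mono sum_abs) auto
    also have "\<dots> \<le> (\<Sum>l\<in>{1..L}. \<bar>\<phi> i l\<bar> * S) + S"
    proof (rule add_mono[OF sum_mono])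
      fix l assume l: "l \<in> {1..L}"
      have "\<bar>\<phi> i l * dd x (r l) * vec_nth (D l) i\<bar> = (\<bar>\<phi> i l\<bar> * \<bar>dd x (r l)\<bar>) * \<bar>vec_nth (D l) i\<bar>"
        by (simp only: abs_mult)
      also have "\<dots> \<le> (\<bar>\<phi> i l\<bar> * 1) * S"
        using dd[OF l] D_le[of l] component_le_norm_cart[of "D l" i] l
        by (intro mult_mono) auto
      finally show "\<bar>\<phi> i l * dd x (r l) * vec_nth (D l) i\<bar> \<le> \<bar>\<phi> i l\<bar> * S" by simp
    next
      show "\<bar>vec_nth (D 0) i\<bar> \<le> S"
        using D_le[of 0] component_le_norm_cart[of "D 0" i] by auto
    qed
    finally show "\<bar>vec_nth ?U i\<bar> \<le> (1 + (\<Sum>l\<in>{1..L}. \<bar>\<phi> i l\<bar>)) * S"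
      by (simp add: distrib_right sum_distrib_right)
  qed
  finally show ?thesis unfolding sum_distrib_right[symmetric] S_def D_def .
qed

section \<open>Covariances of the errors\<close>

lemma L2_product:
  fixes f g :: "'a \<Rightarrow> real"
  assumes [measurable]: "f \<in> borel_measurable M" "g \<in> borel_measurable M"
    and f: "(\<integral>\<^sup>+\<omega>. ennreal ((f \<omega>)\<^sup>2) \<partial>M) \<le> ennreal a" and g: "(\<integral>\<^sup>+\<omega>. ennreal ((g \<omega>)\<^sup>2) \<partial>M) \<le> ennreal b"
    and "0 \<le> a" "0 \<le> b"
  shows "integrable M (\<lambda>\<omega>. f \<omega> * g \<omega>)" and "(\<integral>\<omega>. f \<omega> * g \<omega> \<partial>M)\<^sup>2 \<le> a * b"
proof -
  let ?I = "\<integral>\<^sup>+\<omega>. ennreal (norm (f \<omega> * g \<omega>)) \<partial>M"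
  have "?I\<^sup>2 = (\<integral>\<^sup>+\<omega>. ennreal \<bar>f \<omega>\<bar> * ennreal \<bar>g \<omega>\<bar> \<partial>M)\<^sup>2"
    by (simp add: abs_mult ennreal_mult)
  also have "\<dots> \<le> (\<integral>\<^sup>+\<omega>. (ennreal \<bar>f \<omega>\<bar>)\<^sup>2 \<partial>M) * (\<integral>\<^sup>+\<omega>. (ennreal \<bar>g \<omega>\<bar>)\<^sup>2 \<partial>M)"
    by (rule Cauchy_Schwarz_nn_integral) measurable
  also have "\<dots> \<le> ennreal a * ennreal b"
    using f g by (intro mult_mono) (auto simp: ennreal_power)
  also have "\<dots> = ennreal (a * b)" using assms by (simp add: ennreal_mult)
  finally have I: "?I\<^sup>2 \<le> ennreal (a * b)" .
  then have "?I\<^sup>2 < \<infinity>" by (metis ennreal_less_top infinity_ennreal_def le_less_trans)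
  then have fin: "?I < \<infinity>" by (simp add: power_less_top_ennreal)
  then show int: "integrable M (\<lambda>\<omega>. f \<omega> * g \<omega>)" by (simp add: integrable_iff_bounded)
  have "?I = ennreal (\<integral>\<omega>. norm (f \<omega> * g \<omega>) \<partial>M)"
    using int by (intro nn_integral_eq_integral) auto
  with I have "ennreal ((\<integral>\<omega>. norm (f \<omega> * g \<omega>) \<partial>M)\<^sup>2) \<le> ennreal (a * b)"
    by (simp add: ennreal_power)
  then have "(\<integral>\<omega>. norm (f \<omega> * g \<omega>) \<partial>M)\<^sup>2 \<le> a * b"
    using assms by (simp add: ennreal_le_iff)
  moreover have "\<bar>\<integral>\<omega>. f \<omega> * g \<omega> \<partial>M\<bar>\<^sup>2 \<le> (\<integral>\<omega>. norm (f \<omega> * g \<omega>) \<partial>M)\<^sup>2"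
    using integral_norm_bound[of M "\<lambda>\<omega>. f \<omega> * g \<omega>"] by (intro power_mono) auto
  ultimately show "(\<integral>\<omega>. f \<omega> * g \<omega> \<partial>M)\<^sup>2 \<le> a * b" by simp
qed

text \<open>With truncated subtraction \<open>(t - t') + (t' - t)\<close> is the distance of
  \<open>t\<close> and \<open>t'\<close>. For fixed \<open>t\<close> each distance occurs at most
  once on either side, hence the factor 2.\<close>

lemma sum_distance_le:
  fixes a :: "nat \<Rightarrow> real"
  assumes a: "\<And>h. 0 \<le> a h" "summable a"
  shows "(\<Sum>t<T. \<Sum>t'<T. a ((t - t') + (t' - t))) \<le> real T * (2 * (\<Sum>h. a h))"
proof -
  have "(\<Sum>t'<T. a ((t - t') + (t' - t))) \<le> 2 * (\<Sum>h. a h)" if "t < T" for t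
  proof -
    have split: "{..<T} = {..t} \<union> {t<..<T}" using that by auto
    have "(\<Sum>t'<T. a ((t - t') + (t' - t)))
      = (\<Sum>t'\<in>{..t}. a ((t - t') + (t' - t))) + (\<Sum>t'\<in>{t<..<T}. a ((t - t') + (t' - t)))"
      unfolding split by (rule sum.union_disjoint) auto
    also have "(\<Sum>t'\<in>{..t}. a ((t - t') + (t' - t))) = (\<Sum>h\<in>{..t}. a h)"
      by (rule sum.reindex_bij_witness[of _ "\<lambda>h. t - h" "\<lambda>h. t - h"]) auto
    also have "\<dots> \<le> (\<Sum>h. a h)" using a by (intro sum_le_suminf) auto
    also have "(\<Sum>t'\<in>{t<..<T}. a ((t - t') + (t' - t))) = (\<Sum>h\<in>{0<..<T - t}. a h)"
      by (rule sum.reindex_bij_witness[of _ "\<lambda>h. t + h" "\<lambda>h. h - t"]) auto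
    also have "\<dots> \<le> (\<Sum>h. a h)" using a by (intro sum_le_suminf) auto
    finally show ?thesis by simp
  qed
  then have "(\<Sum>t<T. \<Sum>t'<T. a ((t - t') + (t' - t))) \<le> (\<Sum>t<T. 2 * (\<Sum>h. a h))"
    by (intro sum_mono) auto
  then show ?thesis by simp
qed

text \<open>Collects what the covariance bound consumes: independent innovations with bounded second
  moments, geometric coefficients, and one Lipschitz coordinate of \<open>H\<close>. The coordinate
  is a parameter so that the locale can be instantiated at each one.\<close>

locale lipschitz_ma = prob_space M
  for M :: "'a measure" +
  fixes L m :: nat
    and lag :: "'k::finite \<Rightarrow> nat"
    and \<phi> :: "'d::finite \<Rightarrow> nat \<Rightarrow> real"
    and dd :: "real^'q::finite \<Rightarrow> real^'q \<Rightarrow> real"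
    and r s :: "nat \<Rightarrow> real^'q"
    and C :: "nat \<Rightarrow> nat \<Rightarrow> real^'d^'d"
    and e :: "nat \<Rightarrow> int \<Rightarrow> 'a \<Rightarrow> real^'d"
    and H :: "real^'d^'k \<Rightarrow> real^'d"
    and \<nu> :: 'd
    and b \<rho> K LH :: real
  assumes dd_le: "\<And>t l. t \<ge> 1 \<Longrightarrow> l \<in> {1..L} \<Longrightarrow> \<bar>dd (s t) (r l)\<bar> \<le> 1"
    and lag_le: "\<And>k. lag k \<le> m"
    and e_meas: "\<And>l \<tau>. l \<le> L \<Longrightarrow> e l \<tau> \<in> borel_measurable M"
    and e_indep: "indep_vars (\<lambda>_. borel) (\<lambda>(l, t). e l t) ({0..L} \<times> UNIV)"
    and e_L2: "\<And>l \<tau>. l \<le> L \<Longrightarrow> (\<integral>\<^sup>+\<omega>. ennreal ((norm (e l \<tau> \<omega>))\<^sup>2) \<partial>M) \<le> ennreal K"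
    and C_le: "\<And>l j x. l \<le> L \<Longrightarrow> norm (C l j *v x) \<le> b * \<rho> ^ j * norm x"
    and H_lip: "\<And>A B. \<bar>vec_nth (H A) \<nu> - vec_nth (H B) \<nu>\<bar> \<le> LH * norm (A - B)"
    and const_bounds: "0 \<le> b" "0 \<le> \<rho>" "\<rho> < 1" "0 \<le> K" "0 \<le> LH"
begin

text \<open>The uncentred response as a functional of an arbitrary innovation array. The free sample
  space lets it be evaluated on \<open>M\<close>, on product spaces and on a single point.\<close>

definition resp :: "(nat \<Rightarrow> int \<Rightarrow> 'b \<Rightarrow> real^'d) \<Rightarrow> nat \<Rightarrow> 'b \<Rightarrow> real" where
  "resp e' t \<omega> = vec_nth (H (\<chi> k. U_field L \<phi> dd r C e' (int t - int (lag k)) (s t) \<omega>)) \<nu>"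

definition clip :: "int \<Rightarrow> nat \<Rightarrow> int \<Rightarrow> 'a \<Rightarrow> real^'d" where
  "clip \<sigma> l \<tau> \<omega> = (if \<tau> \<le> \<sigma> then 0 else e l \<tau> \<omega>)"

definition noise :: "nat \<Rightarrow> 'a \<Rightarrow> real" where
  "noise t \<omega> = resp e t \<omega> - expectation (resp e t)"

text \<open>The value at \<open>h = 0\<close> of the clipping estimate. Of the two factors counting
  pairs of a lag and a process, one comes from Cauchy-Schwarz for finite sums and the other from
  adding their second moments.\<close>

definition var_bound :: real where
  "var_bound = (LH * (\<Sum>i\<in>UNIV. 1 + (\<Sum>l\<in>{1..L}. \<bar>\<phi> i l\<bar>)))\<^sup>2
    * (real (CARD('k) * Suc L))\<^sup>2 * ((b / (1 - \<rho>))\<^sup>2 * K)"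

lemma var_bound_nonneg: "0 \<le> var_bound"
  using const_bounds by (simp add: var_bound_def)

lemma resp_measurable:
  assumes "\<And>l \<tau>. l \<le> L \<Longrightarrow> e' l \<tau> \<in> borel_measurable N"
  shows "resp e' t \<in> borel_measurable N"
proof -
  have "LH-lipschitz_on UNIV (\<lambda>A. vec_nth (H A) \<nu>)"
    using H_lip const_bounds by (intro lipschitz_onI) (auto simp: dist_norm)
  then have "(\<lambda>A. vec_nth (H A) \<nu>) \<in> borel_measurable borel"
    by (intro borel_measurable_continuous_onI lipschitz_on_continuous_on)
  moreover have "(\<lambda>\<omega>. \<chi> k. U_field L \<phi> dd r C e' (int t - int (lag k)) (s t) \<omega>) \<in> borel_measurable N"
    by (intro borel_measurable_vec_lambda U_field_measurable assms)
  ultimately show ?thesis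
    unfolding resp_def[abs_def] by (rule measurable_compose[rotated])
qed

lemma resp_cong:
  assumes "\<And>l \<tau>. l \<le> L \<Longrightarrow> \<tau> \<le> int t \<Longrightarrow> e1 l \<tau> \<omega> = e2 l \<tau> \<omega>'"
  shows "resp e1 t \<omega> = resp e2 t \<omega>'"
proof -
  have "U_field L \<phi> dd r C e1 (int t - int (lag k)) (s t) \<omega>
      = U_field L \<phi> dd r C e2 (int t - int (lag k)) (s t) \<omega>'" for k
    using assms by (intro U_field_cong) auto
  then show ?thesis by (simp add: resp_def)
qed

section \<open>Effect of deleting past innovations\<close>

lemma clip_meas: "l \<le> L \<Longrightarrow> clip \<sigma> l \<tau> \<in> borel_measurable M"
  using e_meas[of l \<tau>] by (cases "\<tau> \<le> \<sigma>") (simp_all add: clip_def[abs_def])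

text \<open>By the Lipschitz bounds the change of the response is at most a multiple of the summed
  changes of the linear processes over all lags and indices, and each of these is a geometric tail.
  The alternative \<open>h = 0\<close> imposes no gap, which covers clipping close to or at time
  \<open>t\<close>.\<close>

lemma resp_clip_L2:
  assumes t: "t \<ge> 1" and h: "h = 0 \<or> \<sigma> + int h + int m \<le> int t"
  shows "(\<integral>\<^sup>+\<omega>. ennreal ((resp e t \<omega> - resp (clip \<sigma>) t \<omega>)\<^sup>2) \<partial>M) \<le> ennreal (var_bound * (\<rho> ^ h)\<^sup>2)"
proof -
  define \<Phi> where "\<Phi> = (\<Sum>i\<in>UNIV. 1 + (\<Sum>l\<in>{1..L}. \<bar>\<phi> i l\<bar>))"
  have \<Phi>: "0 \<le> \<Phi>" unfolding \<Phi>_def by (intro sum_nonneg add_nonneg_nonneg) auto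
  let ?N = "real (CARD('k) * Suc L)"
  let ?I = "(UNIV :: 'k set) \<times> {..L}"
  have N: "?N = real (card ?I)" by (simp add: card_cartesian_product)
  define \<Delta> where "\<Delta> i \<omega> = norm (lin_proc (C (snd i)) (e (snd i)) (int t - int (lag (fst i))) \<omega>
      - lin_proc (C (snd i)) (clip \<sigma> (snd i)) (int t - int (lag (fst i))) \<omega>)" for i \<omega>
  have [measurable]: "\<Delta> i \<in> borel_measurable M" if "i \<in> ?I" for i
  proof -
    have [measurable]: "lin_proc (C (snd i)) (e (snd i)) \<tau> \<in> borel_measurable M"
        "lin_proc (C (snd i)) (clip \<sigma> (snd i)) \<tau> \<in> borel_measurable M" for \<tau>
      using that by (auto intro!: lin_proc_measurable e_meas clip_meas)
    show ?thesis unfolding \<Delta>_def[abs_def] by measurable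
  qed
  have pt: "(resp e t \<omega> - resp (clip \<sigma>) t \<omega>)\<^sup>2 \<le> (LH * \<Phi>)\<^sup>2 * ?N * (\<Sum>i\<in>?I. (\<Delta> i \<omega>)\<^sup>2)" for \<omega>
  proof -
    let ?A = "\<lambda>e'. \<chi> k. U_field L \<phi> dd r C e' (int t - int (lag k)) (s t) \<omega>"
    have "norm (?A e - ?A (clip \<sigma>)) \<le> (\<Sum>k\<in>UNIV. norm (vec_nth (?A e - ?A (clip \<sigma>)) k))"
      by (simp add: norm_vec_def L2_set_le_sum)
    also have "\<dots> \<le> (\<Sum>k\<in>UNIV. \<Phi> * (\<Sum>l\<le>L. \<Delta> (k, l) \<omega>))"
      unfolding \<Delta>_def \<Phi>_def vector_minus_component vec_lambda_beta fst_conv snd_conv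
      by (intro sum_mono norm_U_field_diff_le dd_le[OF t])
    also have "\<dots> = \<Phi> * (\<Sum>i\<in>?I. \<Delta> i \<omega>)"
      by (simp add: sum_distrib_left sum.cartesian_product)
    finally have "LH * norm (?A e - ?A (clip \<sigma>)) \<le> LH * (\<Phi> * (\<Sum>i\<in>?I. \<Delta> i \<omega>))"
      using const_bounds by (intro mult_left_mono)
    then have "\<bar>resp e t \<omega> - resp (clip \<sigma>) t \<omega>\<bar> \<le> LH * \<Phi> * (\<Sum>i\<in>?I. \<Delta> i \<omega>)"
      unfolding resp_def using H_lip[of "?A e" "?A (clip \<sigma>)"] by (simp add: mult.assoc)
    then have "\<bar>resp e t \<omega> - resp (clip \<sigma>) t \<omega>\<bar>\<^sup>2 \<le> (LH * \<Phi> * (\<Sum>i\<in>?I. \<Delta> i \<omega>))\<^sup>2"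
      by (intro power_mono) auto
    also have "\<dots> = (LH * \<Phi>)\<^sup>2 * (\<Sum>i\<in>?I. \<Delta> i \<omega>)\<^sup>2" by (rule power_mult_distrib)
    also have "\<dots> \<le> (LH * \<Phi>)\<^sup>2 * ((\<Sum>i\<in>?I. (\<Delta> i \<omega>)\<^sup>2) * ?N)"
      unfolding N by (intro mult_left_mono sum_squared_le_sum_of_squares) auto
    finally show ?thesis by (simp add: mult_ac)
  qed
  let ?c = "(b * \<rho> ^ h / (1 - \<rho>))\<^sup>2 * K"
  have D: "(\<integral>\<^sup>+\<omega>. ennreal ((\<Delta> i \<omega>)\<^sup>2) \<partial>M) \<le> ennreal ?c" if i: "i \<in> ?I" for i
    unfolding \<Delta>_def
  proof (rule lin_proc_diff_L2)
    \<comment> \<open>The oldest time read is at least \<open>t - m - (h - 1)\<close>, which lies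
      strictly after \<sigma>; hence the gap of \<open>h + m\<close>.\<close>
    fix j \<omega> assume "j < h"
    then show "clip \<sigma> (snd i) (int t - int (lag (fst i)) - int j) \<omega> = e (snd i) (int t - int (lag (fst i)) - int j) \<omega>"
      using h lag_le[of "fst i"] by (auto simp: clip_def)
  qed (use i e_meas clip_meas e_L2 C_le const_bounds in \<open>auto simp: clip_def\<close>)
  have "(\<integral>\<^sup>+\<omega>. ennreal ((resp e t \<omega> - resp (clip \<sigma>) t \<omega>)\<^sup>2) \<partial>M)
      \<le> (\<integral>\<^sup>+\<omega>. ennreal ((LH * \<Phi>)\<^sup>2 * ?N) * (\<Sum>i\<in>?I. ennreal ((\<Delta> i \<omega>)\<^sup>2)) \<partial>M)"
    using pt by (intro nn_integral_mono) (simp add: ennreal_mult[symmetric] sum_ennreal sum_nonneg ennreal_leI)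
  also have "\<dots> = ennreal ((LH * \<Phi>)\<^sup>2 * ?N) * (\<Sum>i\<in>?I. \<integral>\<^sup>+\<omega>. ennreal ((\<Delta> i \<omega>)\<^sup>2) \<partial>M)"
    by (subst nn_integral_cmult, measurable) (subst nn_integral_sum, measurable)
  also have "\<dots> \<le> ennreal ((LH * \<Phi>)\<^sup>2 * ?N) * (\<Sum>i\<in>?I. ennreal ?c)"
    by (intro mult_left_mono sum_mono D) auto
  also have "(\<Sum>i\<in>?I. ennreal ?c) = ennreal (?N * ?c)"
    using const_bounds by (subst sum_ennreal) (auto simp: card_cartesian_product)
  also have "ennreal ((LH * \<Phi>)\<^sup>2 * ?N) * ennreal (?N * ?c) = ennreal (((LH * \<Phi>)\<^sup>2 * ?N) * (?N * ?c))"
    using const_bounds by (intro ennreal_mult[symmetric]) auto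
  also have "((LH * \<Phi>)\<^sup>2 * ?N) * (?N * ?c) = var_bound * (\<rho> ^ h)\<^sup>2"
    unfolding var_bound_def \<Phi>_def[symmetric] by (simp add: power2_eq_square mult_ac)
  finally show ?thesis .
qed

text \<open>The first response reads innovations up to time \<open>t\<close>, the clipped one only
  later ones. They are measurable functions of disjoint blocks of an independent family.\<close>

lemma resp_indep:
  "indep_var borel (resp e t) borel (resp (clip (int t)) t')"
proof -
  let ?A = "{0..L} \<times> {..int t}" and ?B = "{0..L} \<times> {int t<..}"
  \<comment> \<open>Extends a point of a block's product space to a full innovation array. For the
    past block the default 0 is never read, by causality; for the future block it is exactly the
    clipping.\<close>
  define pr :: "(nat \<times> int) set \<Rightarrow> nat \<Rightarrow> int \<Rightarrow> (nat \<times> int \<Rightarrow> real^'d) \<Rightarrow> real^'d"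
    where "pr S l \<tau> x = (if (l, \<tau>) \<in> S then x (l, \<tau>) else 0)" for S l \<tau> x
  have pr: "pr S l \<tau> \<in> borel_measurable (PiM S (\<lambda>_. borel))" for S l \<tau>
    by (cases "(l, \<tau>) \<in> S") (auto simp: pr_def[abs_def] intro: measurable_component_singleton)
  have "indep_var (PiM ?A (\<lambda>_. borel)) (\<lambda>\<omega>. \<lambda>i\<in>?A. (case i of (l, t) \<Rightarrow> e l t) \<omega>)
      (PiM ?B (\<lambda>_. borel)) (\<lambda>\<omega>. \<lambda>i\<in>?B. (case i of (l, t) \<Rightarrow> e l t) \<omega>)"
    by (rule indep_var_restrict[OF e_indep]) auto
  from indep_var_compose[OF this resp_measurable[of "pr ?A", OF pr] resp_measurable[of "pr ?B", OF pr]]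
  have "indep_var borel (resp (pr ?A) t \<circ> (\<lambda>\<omega>. \<lambda>i\<in>?A. (case i of (l, t) \<Rightarrow> e l t) \<omega>))
      borel (resp (pr ?B) t' \<circ> (\<lambda>\<omega>. \<lambda>i\<in>?B. (case i of (l, t) \<Rightarrow> e l t) \<omega>))" .
  moreover have "resp (pr ?A) t \<circ> (\<lambda>\<omega>. \<lambda>i\<in>?A. (case i of (l, t) \<Rightarrow> e l t) \<omega>) = resp e t"
    by (rule ext, simp, rule resp_cong) (auto simp: pr_def)
  moreover have "resp (pr ?B) t' \<circ> (\<lambda>\<omega>. \<lambda>i\<in>?B. (case i of (l, t) \<Rightarrow> e l t) \<omega>) = resp (clip (int t)) t'"
    by (rule ext, simp, rule resp_cong) (auto simp: pr_def clip_def)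
  ultimately show ?thesis by simp
qed

text \<open>Clipping at time \<open>t\<close> itself removes every innovation that is read, so the
  clipped response is a constant \<open>c\<close>. Centring at \<open>c\<close> avoids the mean,
  whose existence is only derived from this bound.\<close>

lemma resp_integrable_sq:
  assumes "t \<ge> 1"
  obtains c where "integrable M (\<lambda>\<omega>. (resp e t \<omega> - c)\<^sup>2)" "expectation (\<lambda>\<omega>. (resp e t \<omega> - c)\<^sup>2) \<le> var_bound"
proof -
  define c where "c = resp (\<lambda>_ _ _. 0) t ()"
  have "resp (clip (int t)) t \<omega> = c" for \<omega>
    unfolding c_def by (rule resp_cong) (simp add: clip_def)
  with resp_clip_L2[OF assms, of 0 "int t"]
  have le: "(\<integral>\<^sup>+\<omega>. ennreal ((resp e t \<omega> - c)\<^sup>2) \<partial>M) \<le> ennreal var_bound" by simp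
  have [measurable]: "resp e t \<in> borel_measurable M" by (rule resp_measurable[OF e_meas])
  have int: "integrable M (\<lambda>\<omega>. (resp e t \<omega> - c)\<^sup>2)"
    using le_less_trans[OF le ennreal_less_top] by (intro integrableI_bounded) auto
  moreover have "ennreal (expectation (\<lambda>\<omega>. (resp e t \<omega> - c)\<^sup>2)) \<le> ennreal var_bound"
    using le nn_integral_eq_integral[OF int] by simp
  then have "expectation (\<lambda>\<omega>. (resp e t \<omega> - c)\<^sup>2) \<le> var_bound"
    using var_bound_nonneg by (simp add: ennreal_le_iff)
  ultimately show ?thesis by (rule that)
qed

lemma resp_integrable: "t \<ge> 1 \<Longrightarrow> integrable M (resp e t)"
proof -
  assume "t \<ge> 1"
  then obtain c where c: "integrable M (\<lambda>\<omega>. (resp e t \<omega> - c)\<^sup>2)" by (rule resp_integrable_sq)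
  have [measurable]: "resp e t \<in> borel_measurable M" by (rule resp_measurable[OF e_meas])
  have "integrable M (\<lambda>\<omega>. resp e t \<omega> - c)"
    by (rule square_integrable_imp_integrable[OF _ c]) measurable
  then have "integrable M (\<lambda>\<omega>. (resp e t \<omega> - c) + c)" by (rule Bochner_Integration.integrable_add) simp
  then show ?thesis by simp
qed

section \<open>Moments and autocovariances of the centred response\<close>

lemma noise_measurable [measurable]: "noise t \<in> borel_measurable M"
  unfolding noise_def[abs_def] by (intro borel_measurable_diff resp_measurable e_meas) auto

lemma noise_mean:
  assumes "t \<ge> 1"
  shows "integrable M (noise t)" "expectation (noise t) = 0"
  using resp_integrable[OF assms] by (auto simp: noise_def[abs_def] prob_space)

text \<open>The second moment about the mean is at most that about any constant, so the bound around
  \<open>c\<close> survives centring.\<close>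

lemma noise_L2:
  assumes t: "t \<ge> 1"
  shows "integrable M (\<lambda>\<omega>. (noise t \<omega>)\<^sup>2)" "expectation (\<lambda>\<omega>. (noise t \<omega>)\<^sup>2) \<le> var_bound"
    "(\<integral>\<^sup>+\<omega>. ennreal ((noise t \<omega>)\<^sup>2) \<partial>M) \<le> ennreal var_bound"
proof -
  obtain c where c: "integrable M (\<lambda>\<omega>. (resp e t \<omega> - c)\<^sup>2)"
      "expectation (\<lambda>\<omega>. (resp e t \<omega> - c)\<^sup>2) \<le> var_bound"
    using t by (rule resp_integrable_sq)
  let ?Y = "\<lambda>\<omega>. resp e t \<omega> - c"
  have Y: "integrable M ?Y" using resp_integrable[OF t] by simp
  have "expectation ?Y = expectation (resp e t) - c" using resp_integrable[OF t] by (simp add: prob_space)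
  then have noise: "noise t = (\<lambda>\<omega>. ?Y \<omega> - expectation ?Y)" by (auto simp: noise_def)
  show int: "integrable M (\<lambda>\<omega>. (noise t \<omega>)\<^sup>2)"
    unfolding noise by (subst power2_diff)
      (intro Bochner_Integration.integrable_add Bochner_Integration.integrable_diff c(1)
        integrable_const integrable_mult_left integrable_mult_right Y)
  show le: "expectation (\<lambda>\<omega>. (noise t \<omega>)\<^sup>2) \<le> var_bound"
    unfolding noise using variance_eq[OF Y c(1)] c(2) zero_le_power2[of "expectation ?Y"] by linarith
  show "(\<integral>\<^sup>+\<omega>. ennreal ((noise t \<omega>)\<^sup>2) \<partial>M) \<le> ennreal var_bound"
    using nn_integral_eq_integral[OF int] le by (simp add: ennreal_leI)
qed

text \<open>Setting the innovations up to time \<open>t'\<close> to zero makes the response at time \<open>t\<close> independent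
  of the noise at time \<open>t'\<close>, at a cost that is geometrically small in \<open>t - t'\<close>.\<close>
lemma noise_cov_le_of_less:
  assumes t': "t' \<ge> 1" "t' < t"
  shows "\<bar>expectation (\<lambda>\<omega>. noise t' \<omega> * noise t \<omega>)\<bar> \<le> var_bound * \<rho> ^ (t - t' - m)"
proof -
  \<comment> \<open>Truncated subtraction: for gaps up to \<open>m\<close> this is 0 and the bound
    reduces to \<open>var_bound\<close>.\<close>
  define h where "h = t - t' - m"
  have t: "t \<ge> 1" using t' by simp
  let ?Y = "resp (clip (int t')) t"
  define W where "W \<omega> = resp e t \<omega> - ?Y \<omega>" for \<omega>
  have [measurable]: "resp e t \<in> borel_measurable M" "?Y \<in> borel_measurable M"
    by (auto intro!: resp_measurable e_meas clip_meas)
  have [measurable]: "W \<in> borel_measurable M" unfolding W_def[abs_def] by measurable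
  have WL2: "(\<integral>\<^sup>+\<omega>. ennreal ((W \<omega>)\<^sup>2) \<partial>M) \<le> ennreal (var_bound * (\<rho> ^ h)\<^sup>2)"
    unfolding W_def by (rule resp_clip_L2[OF t]) (auto simp: h_def)
  have W2: "integrable M (\<lambda>\<omega>. (W \<omega>)\<^sup>2)"
    using le_less_trans[OF WL2 ennreal_less_top] by (intro integrableI_bounded) auto
  then have W: "integrable M W" by (rule square_integrable_imp_integrable[rotated]) measurable
  have "integrable M (\<lambda>\<omega>. resp e t \<omega> - W \<omega>)" using W resp_integrable[OF t] by simp
  then have Y: "integrable M ?Y" by (simp add: W_def)
  note P = L2_product[OF _ _ noise_L2(3)[OF t'(1)] WL2]
  have PI: "integrable M (\<lambda>\<omega>. noise t' \<omega> * W \<omega>)"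
    by (rule P(1)) (auto simp: var_bound_nonneg)
  have "(expectation (\<lambda>\<omega>. noise t' \<omega> * W \<omega>))\<^sup>2 \<le> var_bound * (var_bound * (\<rho> ^ h)\<^sup>2)"
    by (rule P(2)) (auto simp: var_bound_nonneg)
  then have "\<bar>expectation (\<lambda>\<omega>. noise t' \<omega> * W \<omega>)\<bar>\<^sup>2 \<le> (var_bound * \<rho> ^ h)\<^sup>2"
    by (simp add: power2_eq_square mult_ac)
  then have PE: "\<bar>expectation (\<lambda>\<omega>. noise t' \<omega> * W \<omega>)\<bar> \<le> var_bound * \<rho> ^ h"
    by (rule power2_le_imp_le) (simp add: var_bound_nonneg const_bounds)
  have "indep_var borel ((\<lambda>x. x - expectation (resp e t')) \<circ> resp e t') borel ((\<lambda>x. x) \<circ> ?Y)"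
    by (rule indep_var_compose[OF resp_indep]) auto
  then have ind: "indep_var borel (noise t') borel ?Y"
    by (simp add: comp_def noise_def[abs_def])
  have YI: "integrable M (\<lambda>\<omega>. noise t' \<omega> * ?Y \<omega>)"
    by (rule indep_var_integrable[OF ind noise_mean(1)[OF t'(1)] Y])
  have YE: "expectation (\<lambda>\<omega>. noise t' \<omega> * ?Y \<omega>) = 0"
    using indep_var_lebesgue_integral[OF ind noise_mean(1)[OF t'(1)] Y] noise_mean(2)[OF t'(1)] by simp
  \<comment> \<open>Of the three terms only the one with \<open>W\<close> has nonzero mean in
    general: the second factorises by independence, and \<open>noise t'\<close> is centred.\<close>
  have "(\<lambda>\<omega>. noise t' \<omega> * noise t \<omega>)
      = (\<lambda>\<omega>. noise t' \<omega> * W \<omega> + noise t' \<omega> * ?Y \<omega> - expectation (resp e t) * noise t' \<omega>)"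
    by (auto simp: W_def noise_def[of t] algebra_simps)
  then have "expectation (\<lambda>\<omega>. noise t' \<omega> * noise t \<omega>) = expectation (\<lambda>\<omega>. noise t' \<omega> * W \<omega>)"
    using PI YI YE noise_mean[OF t'(1)] by simp
  with PE show ?thesis by (simp add: h_def)
qed

lemma noise_prod_integrable:
  "t \<ge> 1 \<Longrightarrow> t' \<ge> 1 \<Longrightarrow> integrable M (\<lambda>\<omega>. noise t \<omega> * noise t' \<omega>)"
  by (rule L2_product(1)[OF _ _ noise_L2(3) noise_L2(3)]) (auto simp: var_bound_nonneg)

lemma noise_cov_le:
  assumes "t \<ge> 1" "t' \<ge> 1"
  shows "\<bar>expectation (\<lambda>\<omega>. noise t \<omega> * noise t' \<omega>)\<bar> \<le> var_bound * \<rho> ^ ((t - t') + (t' - t) - m)"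
proof -
  consider "t < t'" | "t = t'" | "t' < t" by linarith
  then show ?thesis
  proof cases
    case 1
    then show ?thesis using noise_cov_le_of_less[of t t'] assms by simp
  next
    case 2
    then show ?thesis using noise_L2(2)[OF assms(1)] by (simp add: power2_eq_square)
  next
    case 3
    then show ?thesis using noise_cov_le_of_less[of t' t] assms by (simp add: mult.commute)
  qed
qed

text \<open>Expanding the square leaves a double sum of covariances that depends on distances only,
  so it grows linearly in \<open>T\<close>. Error times start at 1 while rows are counted from 0;
  the common shift leaves distances unchanged.\<close>

lemma weighted_noise_L2:
  assumes x: "\<And>t. t < T \<Longrightarrow> \<bar>x t\<bar> \<le> B"
  shows "integrable M (\<lambda>\<omega>. (\<Sum>t<T. x t * noise (t + 1) \<omega>)\<^sup>2)"
    and "expectation (\<lambda>\<omega>. (\<Sum>t<T. x t * noise (t + 1) \<omega>)\<^sup>2)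
      \<le> B\<^sup>2 * var_bound * (real T * (2 * (\<Sum>h. \<rho> ^ (h - m))))"
proof -
  have eq: "(\<Sum>t<T. x t * noise (t + 1) \<omega>)\<^sup>2
      = (\<Sum>t<T. \<Sum>t'<T. (x t * x t') * (noise (t + 1) \<omega> * noise (t' + 1) \<omega>))" for \<omega>
    by (simp add: power2_eq_square sum_product mult_ac)
  have int: "integrable M (\<lambda>\<omega>. (x t * x t') * (noise (t + 1) \<omega> * noise (t' + 1) \<omega>))" for t t'
    by (intro integrable_mult_right noise_prod_integrable) auto
  show "integrable M (\<lambda>\<omega>. (\<Sum>t<T. x t * noise (t + 1) \<omega>)\<^sup>2)"
    unfolding eq by (intro Bochner_Integration.integrable_sum int)
  \<comment> \<open>After dropping the first \<open>m\<close> terms, where the truncated exponent is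
    constantly 0, a geometric series remains.\<close>
  have "summable (\<lambda>h. \<rho> ^ (h + m - m))"
    using const_bounds by (simp add: summable_geometric)
  then have sum: "summable (\<lambda>h. \<rho> ^ (h - m))"
    using summable_iff_shift[of "\<lambda>h. \<rho> ^ (h - m)" m] by simp
  have "expectation (\<lambda>\<omega>. (\<Sum>t<T. x t * noise (t + 1) \<omega>)\<^sup>2)
    = (\<Sum>t<T. \<Sum>t'<T. expectation (\<lambda>\<omega>. (x t * x t') * (noise (t + 1) \<omega> * noise (t' + 1) \<omega>)))"
    unfolding eq
    by (subst Bochner_Integration.integral_sum, intro Bochner_Integration.integrable_sum int)
      (intro sum.cong refl Bochner_Integration.integral_sum int)
  also have "\<dots> \<le> (\<Sum>t<T. \<Sum>t'<T. (B * B) * (var_bound * \<rho> ^ ((t - t') + (t' - t) - m)))"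
  proof (intro sum_mono)
    fix t t' assume t: "t \<in> {..<T}" "t' \<in> {..<T}"
    let ?E = "expectation (\<lambda>\<omega>. noise (t + 1) \<omega> * noise (t' + 1) \<omega>)"
    have "expectation (\<lambda>\<omega>. (x t * x t') * (noise (t + 1) \<omega> * noise (t' + 1) \<omega>)) = x t * x t' * ?E"
      by (rule integral_mult_right_zero)
    also have "\<dots> \<le> \<bar>x t\<bar> * \<bar>x t'\<bar> * \<bar>?E\<bar>"
      by (simp only: abs_mult[symmetric] abs_ge_self)
    also have "\<dots> \<le> (B * B) * (var_bound * \<rho> ^ ((t - t') + (t' - t) - m))"
      using noise_cov_le[of "t + 1" "t' + 1"] t x[of t] x[of t']
      by (intro mult_mono) auto
    finally show "expectation (\<lambda>\<omega>. (x t * x t') * (noise (t + 1) \<omega> * noise (t' + 1) \<omega>))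
      \<le> (B * B) * (var_bound * \<rho> ^ ((t - t') + (t' - t) - m))" .
  qed
  also have "\<dots> = B\<^sup>2 * var_bound * (\<Sum>t<T. \<Sum>t'<T. \<rho> ^ ((t - t') + (t' - t) - m))"
    by (simp add: sum_distrib_left power2_eq_square mult_ac)
  also have "\<dots> \<le> B\<^sup>2 * var_bound * (real T * (2 * (\<Sum>h. \<rho> ^ (h - m))))"
    using sum_distance_le[OF _ sum] const_bounds var_bound_nonneg by (intro mult_left_mono) auto
  finally show "expectation (\<lambda>\<omega>. (\<Sum>t<T. x t * noise (t + 1) \<omega>)\<^sup>2)
      \<le> B\<^sup>2 * var_bound * (real T * (2 * (\<Sum>h. \<rho> ^ (h - m))))" .
qed

end

lemma integrable_componentwise:
  fixes f :: "'a \<Rightarrow> real^'n"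
  assumes "\<And>i. integrable M (\<lambda>\<omega>. vec_nth (f \<omega>) i)"
  shows "integrable M f"
proof (rule Bochner_Integration.integrable_bound)
  show "integrable M (\<lambda>\<omega>. \<Sum>i\<in>UNIV. \<bar>vec_nth (f \<omega>) i\<bar>)"
    using assms by (intro Bochner_Integration.integrable_sum integrable_abs)
  have "(\<lambda>\<omega>. \<chi> i. vec_nth (f \<omega>) i) \<in> borel_measurable M"
    using assms by (intro borel_measurable_vec_lambda) auto
  then show "f \<in> borel_measurable M" by simp
  show "AE \<omega> in M. norm (f \<omega>) \<le> norm (\<Sum>i\<in>UNIV. \<bar>vec_nth (f \<omega>) i\<bar>)"
    using norm_le_l1_cart by (auto simp: sum_nonneg)
qed

section \<open>Consistency\<close>

text \<open>Markov's inequality for \<open>Q\<close>, the squared norm of the score vector. Its mean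
  grows like \<open>n T\<close> and the threshold like the square of \<open>T\<close>, which leaves
  \<open>n / T\<close>.\<close>

lemma (in lipschitz_ma) ols_deviation_le:
  fixes X :: "real mat"
  assumes X: "X \<in> carrier_mat T n" and \<beta>: "\<beta> \<in> carrier_vec n" and T: "T \<ge> 1"
    and B: "\<And>t j. t < T \<Longrightarrow> j < n \<Longrightarrow> \<bar>X $$ (t, j)\<bar> \<le> B"
    and a: "a > 0" and \<epsilon>: "\<epsilon> > 0"
    and eig: "\<And>c. eigenvalue (smult_mat (1 / real T) (transpose_mat X * X)) c \<Longrightarrow> a \<le> c"
  shows "prob {\<omega> \<in> space M. vnorm (ols X (X *\<^sub>v \<beta> + Matrix.vec T (\<lambda>t. noise (t + 1) \<omega>)) - \<beta>) > \<epsilon>}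
    \<le> 2 * B\<^sup>2 * var_bound * (\<Sum>h. \<rho> ^ (h - m)) / (a * \<epsilon>)\<^sup>2 * (real n / real T)"
proof -
  let ?w = "\<lambda>\<omega>. Matrix.vec T (\<lambda>t. noise (t + 1) \<omega>)"
  let ?A = "{\<omega> \<in> space M. vnorm (ols X (X *\<^sub>v \<beta> + ?w \<omega>) - \<beta>) > \<epsilon>}"
  let ?S = "\<Sum>h. \<rho> ^ (h - m)"
  define Q where "Q \<omega> = (\<Sum>j<n. (\<Sum>t<T. X $$ (t, j) * noise (t + 1) \<omega>)\<^sup>2)" for \<omega>
  have Q: "(vnorm (transpose_mat X *\<^sub>v ?w \<omega>))\<^sup>2 = Q \<omega>" for \<omega>
    using X by (simp add: vnorm_def Q_def sum_nonneg scalar_prod_def atLeast0LessThan)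
  have int: "integrable M Q"
    unfolding Q_def[abs_def] using B
    by (intro Bochner_Integration.integrable_sum weighted_noise_L2(1)[where B = B]) auto
  have "expectation Q = (\<Sum>j<n. expectation (\<lambda>\<omega>. (\<Sum>t<T. X $$ (t, j) * noise (t + 1) \<omega>)\<^sup>2))"
    unfolding Q_def[abs_def] using B
    by (intro Bochner_Integration.integral_sum weighted_noise_L2(1)[where B = B]) auto
  also have "\<dots> \<le> (\<Sum>j<n. B\<^sup>2 * var_bound * (real T * (2 * ?S)))"
    using B by (intro sum_mono weighted_noise_L2(2)) auto
  finally have EQ: "expectation Q \<le> real n * (B\<^sup>2 * var_bound * (real T * (2 * ?S)))" by simp
  define c where "c = (real T * a * \<epsilon>)\<^sup>2"
  have c: "c > 0" using T a \<epsilon> by (simp add: c_def)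
  \<comment> \<open>The deviation set is compared with a level set of \<open>Q\<close>, and
    measurability is shown for that larger set.\<close>
  have "?A \<subseteq> {\<omega> \<in> space M. Q \<omega> \<ge> c}"
  proof safe
    fix \<omega> assume gt: "\<epsilon> < vnorm (ols X (X *\<^sub>v \<beta> + ?w \<omega>) - \<beta>)"
    have "real T * a * \<epsilon> \<le> real T * a * vnorm (ols X (X *\<^sub>v \<beta> + ?w \<omega>) - \<beta>)"
      using gt T a by (intro mult_left_mono) auto
    also have "\<dots> \<le> vnorm (transpose_mat X *\<^sub>v ?w \<omega>)"
      by (rule ols_error_bound[OF X \<beta> _ T a eig]) auto
    finally have "c \<le> (vnorm (transpose_mat X *\<^sub>v ?w \<omega>))\<^sup>2"
      unfolding c_def using T a \<epsilon> by (intro power_mono) auto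
    then show "c \<le> Q \<omega>" by (simp only: Q)
  qed
  moreover have "{\<omega> \<in> space M. Q \<omega> \<ge> c} \<in> events"
    using borel_measurable_integrable[OF int] by measurable
  ultimately have "prob ?A \<le> prob {\<omega> \<in> space M. Q \<omega> \<ge> c}"
    by (rule finite_measure_mono)
  also have "\<dots> \<le> expectation Q / c"
    by (rule integral_Markov_inequality_measure[OF int, of "{}"]) (auto simp: c Q_def sum_nonneg)
  also have "\<dots> \<le> (real n * (B\<^sup>2 * var_bound * (real T * (2 * ?S)))) / c"
    using EQ c by (intro divide_right_mono) auto
  also have "\<dots> = 2 * B\<^sup>2 * var_bound * ?S / (a * \<epsilon>)\<^sup>2 * (real n / real T)"
    using T a \<epsilon> by (simp add: c_def field_simps power2_eq_square)
  finally show ?thesis .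
qed

text \<open>The first rate carries no information where \<open>p T = 1\<close>, since \<open>ln 1 = 0\<close>; the second rate
  excludes this value for large \<open>T\<close>. Where \<open>p T = 0\<close> the second rate is silent (\<open>x / 0 = 0\<close>), but
  there the ratio is zero.\<close>
lemma dimension_ratio_tendsto_0:
  fixes p :: "nat \<Rightarrow> nat"
  assumes r1: "(\<lambda>T. real (p T) * ln (real (p T)) / real T) \<longlonglongrightarrow> 0"
    and r2: "(\<lambda>T. (ln (real T))\<^sup>2 / sqrt (real (p T))) \<longlonglongrightarrow> 0"
  shows "(\<lambda>T. real (p T) / real T) \<longlonglongrightarrow> 0"
proof (rule Lim_null_comparison)
  have "eventually (\<lambda>T. (ln (real T))\<^sup>2 / sqrt (real (p T)) < 1) sequentially"
    using r2 by (rule order_tendstoD) simp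
  then show "eventually (\<lambda>T. norm (real (p T) / real T)
      \<le> (1 / ln 2) * (real (p T) * ln (real (p T)) / real T)) sequentially"
    using eventually_ge_at_top[of 3]
  proof eventually_elim
    case (elim T)
    have "1 < ln (real T)"
    proof -
      have "exp 1 < real T" using elim(2) exp_le e_less_272 by linarith
      then show ?thesis by (metis exp_gt_zero exp_less_cancel_iff exp_ln less_trans)
    qed
    then have "1 < (ln (real T))\<^sup>2" by simp
    with elim(1) have "p T \<noteq> 1" by auto
    then consider "p T = 0" | "p T \<ge> 2" by linarith
    then show ?case
    proof cases
      case 2
      then have "ln 2 \<le> ln (real (p T))" by simp
      then have "real (p T) / real T * 1 \<le> real (p T) / real T * (ln (real (p T)) / ln 2)"
        by (intro mult_left_mono) auto
      then show ?thesis by (simp add: field_simps)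
    qed simp
  qed
  show "(\<lambda>T. (1 / ln 2) * (real (p T) * ln (real (p T)) / real T)) \<longlonglongrightarrow> 0"
    using tendsto_mult_left[OF r1, of "1 / ln 2"] by simp
qed

text \<open>Pointwise, the square is at most 1 where the argument is at most 1 in modulus and at
  most the higher power elsewhere; total mass one turns the 1 into a constant. The maximum with 0
  covers negative \<open>K\<close>, which \<open>ennreal\<close> sends to zero.\<close>

lemma second_moment_le_of_higher_moment:
  fixes f :: "'a \<Rightarrow> real^'d"
  assumes prob: "prob_space M" and [measurable]: "f \<in> borel_measurable M" and \<delta>: "\<delta> > 0"
    and f: "\<And>i. (\<integral>\<^sup>+\<omega>. ennreal (\<bar>vec_nth (f \<omega>) i\<bar> powr (2 + \<delta>)) \<partial>M) \<le> ennreal K"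
  shows "(\<integral>\<^sup>+\<omega>. ennreal ((norm (f \<omega>))\<^sup>2) \<partial>M) \<le> ennreal (real CARD('d) * (1 + max 0 K))"
proof -
  interpret prob_space M by (rule prob)
  have [measurable]: "(\<lambda>v :: real^'d. vec_nth v i) \<in> borel_measurable borel" for i
    by (intro borel_measurable_continuous_onI continuous_intros)
  have sq: "x\<^sup>2 \<le> 1 + \<bar>x\<bar> powr (2 + \<delta>)" for x :: real
  proof (cases "\<bar>x\<bar> \<le> 1")
    case True
    then have "x\<^sup>2 \<le> 1" by (simp add: abs_square_le_1)
    then show ?thesis by (simp add: add_increasing2)
  next
    case False
    then have "\<bar>x\<bar> powr 2 \<le> \<bar>x\<bar> powr (2 + \<delta>)" using \<delta> by (intro powr_mono) auto
    then show ?thesis using False by (simp add: powr_numeral)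
  qed
  have "(\<integral>\<^sup>+\<omega>. ennreal ((norm (f \<omega>))\<^sup>2) \<partial>M)
      \<le> (\<integral>\<^sup>+\<omega>. (\<Sum>i\<in>UNIV. 1 + ennreal (\<bar>vec_nth (f \<omega>) i\<bar> powr (2 + \<delta>))) \<partial>M)"
  proof (rule nn_integral_mono)
    fix \<omega>
    have "(norm (f \<omega>))\<^sup>2 = (\<Sum>i\<in>UNIV. (vec_nth (f \<omega>) i)\<^sup>2)"
      by (simp add: norm_vec_def L2_set_def sum_nonneg)
    also have "\<dots> \<le> (\<Sum>i\<in>UNIV. 1 + \<bar>vec_nth (f \<omega>) i\<bar> powr (2 + \<delta>))"
      by (intro sum_mono sq)
    finally have "ennreal ((norm (f \<omega>))\<^sup>2) \<le> ennreal (\<Sum>i\<in>UNIV. 1 + \<bar>vec_nth (f \<omega>) i\<bar> powr (2 + \<delta>))"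
      by (rule ennreal_leI)
    also have "\<dots> = (\<Sum>i\<in>UNIV. ennreal (1 + \<bar>vec_nth (f \<omega>) i\<bar> powr (2 + \<delta>)))"
      by (rule sum_ennreal[symmetric]) simp
    also have "\<dots> = (\<Sum>i\<in>UNIV. 1 + ennreal (\<bar>vec_nth (f \<omega>) i\<bar> powr (2 + \<delta>)))"
      by (intro sum.cong refl) (simp add: ennreal_plus)
    finally show "ennreal ((norm (f \<omega>))\<^sup>2)
      \<le> (\<Sum>i\<in>UNIV. 1 + ennreal (\<bar>vec_nth (f \<omega>) i\<bar> powr (2 + \<delta>)))" .
  qed
  also have "\<dots> = (\<Sum>i\<in>UNIV. 1 + (\<integral>\<^sup>+\<omega>. ennreal (\<bar>vec_nth (f \<omega>) i\<bar> powr (2 + \<delta>)) \<partial>M))"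
    by (subst nn_integral_sum, measurable)
      (intro sum.cong refl, simp add: nn_integral_add emeasure_space_1)
  also have "\<dots> \<le> (\<Sum>i\<in>(UNIV :: 'd set). ennreal (1 + max 0 K))"
  proof (rule sum_mono)
    fix i
    have "1 + (\<integral>\<^sup>+\<omega>. ennreal (\<bar>vec_nth (f \<omega>) i\<bar> powr (2 + \<delta>)) \<partial>M) \<le> 1 + ennreal (max 0 K)"
      by (intro add_left_mono order_trans[OF f] ennreal_leI) simp
    then show "1 + (\<integral>\<^sup>+\<omega>. ennreal (\<bar>vec_nth (f \<omega>) i\<bar> powr (2 + \<delta>)) \<partial>M) \<le> ennreal (1 + max 0 K)"
      by (simp add: ennreal_plus)
  qed
  also have "\<dots> = ennreal (real CARD('d) * (1 + max 0 K))"
    by (subst sum_ennreal) auto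
  finally show ?thesis .
qed

theorem theorem4:
  fixes M :: "'a measure"
    and L m :: nat
    and lag :: "'k::finite \<Rightarrow> nat"
    and \<phi> :: "'d::finite \<Rightarrow> nat \<Rightarrow> real"
    and dd :: "real^'q::finite \<Rightarrow> real^'q \<Rightarrow> real"
    and r :: "nat \<Rightarrow> real^'q"
    and s :: "nat \<Rightarrow> real^'q"
    and C :: "nat \<Rightarrow> nat \<Rightarrow> real^'d^'d"
    and e :: "nat \<Rightarrow> int \<Rightarrow> 'a \<Rightarrow> real^'d"
    and Sig :: "nat \<Rightarrow> int \<Rightarrow> real^'d^'d"
    and u :: "nat \<Rightarrow> int \<Rightarrow> 'a \<Rightarrow> real^'d"
    and H :: "real^'d^'k \<Rightarrow> real^'d"
    and \<delta> :: real
    and p :: "nat \<Rightarrow> nat"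
    and X :: "nat \<Rightarrow> real mat"
    and \<beta> :: "nat \<Rightarrow> real vec"
    and \<nu> :: 'd
    and Uf :: "int \<Rightarrow> real^'q \<Rightarrow> 'a \<Rightarrow> real^'d"
    and err :: "nat \<Rightarrow> 'a \<Rightarrow> real^'d"
  defines "Uf \<equiv> U_field L \<phi> dd r C e"
    and "err \<equiv> err_proc M H lag Uf s"
  assumes prob: "prob_space M"
    \<comment> \<open>spatial structure\<close>
    and sites: "\<forall>l\<in>{1..L}. \<forall>i. r l $ i \<in> {0..1}"
    and locs: "\<forall>t\<ge>1. \<forall>i. s t $ i \<in> {0..1}"
    and dd_range: "\<forall>x y. (\<forall>i. x $ i \<in> {0..1}) \<and> (\<forall>i. y $ i \<in> {0..1}) \<longrightarrow> dd x y \<in> {0..1}"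
    and lag: "bij_betw lag UNIV {0..m}"
    \<comment> \<open>(E1)\<close>
    and E1_meas: "\<forall>l\<in>{0..L}. \<forall>t. e l t \<in> borel_measurable M"
    and E1_indep: "prob_space.indep_vars M (\<lambda>_. borel) (\<lambda>(l, t). e l t) ({0..L} \<times> UNIV)"
    and E1_mean: "\<forall>l\<in>{0..L}. \<forall>t. integrable M (e l t) \<and> integral\<^sup>L M (e l t) = 0"
    and E1_struct: "\<forall>l\<in>{0..L}. \<forall>t. pos_def (Sig l t) \<and> u l t \<in> borel_measurable M
        \<and> integrable M (u l t) \<and> integral\<^sup>L M (u l t) = 0
        \<and> prob_space.indep_vars M (\<lambda>_. borel) (\<lambda>i \<omega>. u l t \<omega> $ i) UNIV
        \<and> (\<forall>\<omega>\<in>space M. e l t \<omega> = mat_sqrt (Sig l t) *v u l t \<omega>)"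
    \<comment> \<open>(E2)\<close>
    and \<delta>_pos: "\<delta> > 0"
    and E2: "\<exists>K::real. \<forall>l\<in>{0..L}. \<forall>t i.
        (\<integral>\<^sup>+\<omega>. ennreal (\<bar>e l t \<omega> $ i\<bar> powr (2 + \<delta>)) \<partial>M) \<le> ennreal K"
    \<comment> \<open>(E3)\<close>
    and E3: "CARD('d) = 1 \<longrightarrow> (\<exists>K::real. \<forall>l\<in>{0..L}. \<forall>t i.
        (\<integral>\<^sup>+\<omega>. ennreal ((e l t \<omega> $ i)^2) \<partial>M) \<le> ennreal K)"
    \<comment> \<open>(E4)\<close>
    and E4_1: "CARD('d) = 1 \<longrightarrow> (\<exists>\<sigma>>0. \<forall>t i. integral\<^sup>L M (\<lambda>\<omega>. (e 0 t \<omega> $ i)^2) \<ge> \<sigma>^2)"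
    and E4_2: "CARD('d) > 1 \<longrightarrow> (\<exists>c>0. \<forall>t. lambda_min (Sig 0 t) \<ge> c)"
    \<comment> \<open>(E5)\<close>
    and E5: "\<exists>dens :: nat \<Rightarrow> int \<Rightarrow> 'd \<Rightarrow> real \<Rightarrow> real.
        (\<forall>l\<in>{0..L}. \<forall>t i. (\<forall>z. dens l t i z \<ge> 0)
           \<and> distributed M lborel (\<lambda>\<omega>. e l t \<omega> $ i) (\<lambda>z. ennreal (dens l t i z)))
        \<and> (\<exists>K::real. \<forall>l\<in>{0..L}. \<forall>t i x.
           (\<integral>\<^sup>+z. ennreal \<bar>dens l t i (z + x) - dens l t i z\<bar> \<partial>lborel) \<le> ennreal (K * \<bar>x\<bar>))"
    \<comment> \<open>(E7)\<close>
    and E7_lip: "\<exists>LH::real. \<forall>A B i. \<bar>H A $ i - H B $ i\<bar> \<le> LH * norm (A - B)"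
    and E7_mom: "\<exists>\<Xi> :: 'a \<Rightarrow> real^'d^'k. \<Xi> \<in> borel_measurable M
        \<and> prob_space.indep_set M {\<Xi> -` A \<inter> space M | A. A \<in> sets borel}
             (sigma_sets (space M) {(\<lambda>\<omega>. Uf t x \<omega>) -` A \<inter> space M | t x A. A \<in> sets borel})
        \<and> (\<forall>i. (\<integral>\<^sup>+\<omega>. ennreal (\<bar>H (\<Xi> \<omega>) $ i\<bar> powr (2 + \<delta>)) \<partial>M) < \<infinity>)"
    \<comment> \<open>geometric decay of the coefficients\<close>
    and geom: "\<exists>K \<rho>::real. 0 \<le> \<rho> \<and> \<rho> < 1 \<and> (\<forall>l\<in>{0..L}. \<forall>j i. infnorm (C l j $ i) \<le> K * \<rho> ^ j)"
    \<comment> \<open>regressors: T x p(T) design matrices, row t-1 is x_t\<close>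
    and X_dim: "\<forall>T\<ge>1. X T \<in> carrier_mat T (p T)"
    and \<beta>_dim: "\<forall>T\<ge>1. \<beta> T \<in> carrier_vec (p T)"
    and full_rank: "\<forall>T\<ge>1. vec_space.rank T (X T) = min T (p T)"
    \<comment> \<open>(R)\<close>
    and R_bdd: "\<exists>B::real. \<forall>T\<ge>1. \<forall>t<T. \<forall>j<p T. \<bar>X T $$ (t, j)\<bar> \<le> B"
    and R: "\<exists>(Sx :: nat \<Rightarrow> real mat) (\<eta>::real) (Cc::real) (a::real) b. \<eta> \<ge> 0 \<and> 0 < a \<and> a \<le> b \<and>
        (\<forall>T\<ge>1. Sx (p T) \<in> carrier_mat (p T) (p T) \<and> pos_def_mat (Sx (p T))
          \<and> spec_norm (smult_mat (1 / real T) (transpose_mat (X T) * X T) - Sx (p T))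
               \<le> Cc * real (p T) powr \<eta> / sqrt (real T)
          \<and> (\<forall>c. eigenvalue (smult_mat (1 / real T) (transpose_mat (X T) * X T)) c \<longrightarrow> c \<in> {a..b}))"
    \<comment> \<open>boundedness |x_{tj} eps_t^{(nu')}| <= 1\<close>
    and bdd: "\<forall>T\<ge>1. \<forall>t\<in>{1..T}. \<forall>j\<in>{1..p T}. \<forall>i.
        AE \<omega> in M. \<bar>X T $$ (t - 1, j - 1) * (err t \<omega> $ i)\<bar> \<le> 1"
    \<comment> \<open>rates\<close>
    and rate1: "(\<lambda>T. real (p T) * ln (real (p T)) / real T) \<longlonglongrightarrow> 0"
    and rate2: "(\<lambda>T. (ln (real T))^2 / sqrt (real (p T))) \<longlonglongrightarrow> 0"
  shows "\<forall>\<epsilon>>0. (\<lambda>T. measure M {\<omega> \<in> space M.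
           vnorm (ols (X T) (X T *\<^sub>v \<beta> T + Matrix.vec T (\<lambda>t. err (t + 1) \<omega> $ \<nu>)) - \<beta> T) > \<epsilon>})
         \<longlonglongrightarrow> 0"
proof (intro allI impI)
  fix \<epsilon> :: real assume \<epsilon>: "\<epsilon> > 0"
  interpret prob_space M by (rule prob)
  obtain KE where KE: "\<forall>l\<in>{0..L}. \<forall>t i.
      (\<integral>\<^sup>+\<omega>. ennreal (\<bar>vec_nth (e l t \<omega>) i\<bar> powr (2 + \<delta>)) \<partial>M) \<le> ennreal KE"
    using E2 by blast
  obtain LH where LH: "\<And>A B i. \<bar>vec_nth (H A) i - vec_nth (H B) i\<bar> \<le> LH * norm (A - B)"
    using E7_lip by blast
  obtain KC \<rho> where \<rho>: "0 \<le> \<rho>" "\<rho> < 1"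
    and KC: "\<And>l j i. l \<le> L \<Longrightarrow> infnorm (vec_nth (C l j) i) \<le> KC * \<rho> ^ j"
    using geom by (metis atLeastAtMost_iff le0)
  have KC0: "0 \<le> KC"
    using KC[of 0 0 undefined] infnorm_pos_le[of "vec_nth (C 0 0) undefined"] by simp
  obtain B where B: "\<And>T t j. T \<ge> 1 \<Longrightarrow> t < T \<Longrightarrow> j < p T \<Longrightarrow> \<bar>X T $$ (t, j)\<bar> \<le> B"
    using R_bdd by blast
  obtain a where a: "a > 0" and eig: "\<And>T c. T \<ge> 1 \<Longrightarrow>
      eigenvalue (smult_mat (1 / real T) (transpose_mat (X T) * X T)) c \<Longrightarrow> a \<le> c"
  proof -
    from R obtain a b' where ab: "0 < a" "\<forall>T\<ge>1. \<forall>c.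
        eigenvalue (smult_mat (1 / real T) (transpose_mat (X T) * X T)) c \<longrightarrow> c \<in> {a..b'}"
      by blast
    show ?thesis by (rule that[OF ab(1)]) (use ab(2) in auto)
  qed
  define b where "b = real CARD('d) * sqrt (real CARD('d)) * KC"
  define K where "K = real CARD('d) * (1 + max 0 KE)"
  \<comment> \<open>All coordinates \<open>i\<close> are covered, since the centring in
    \<open>err\<close> is a vector-valued integral. The modulus of \<open>LH\<close> supplies the
    sign required by the locale.\<close>
  have ma: "lipschitz_ma M L m lag dd r s C e H i b \<rho> K \<bar>LH\<bar>" for i
  proof unfold_locales
    show "\<bar>dd (s t) (r l)\<bar> \<le> 1" if "1 \<le> t" "l \<in> {1..L}" for t l
    proof -
      have "dd (s t) (r l) \<in> {0..1}"
        using dd_range locs sites that by blast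
      then show ?thesis by simp
    qed
    show "lag k \<le> m" for k using lag by (auto simp: bij_betw_def)
    show "e l \<tau> \<in> borel_measurable M" if "l \<le> L" for l \<tau> using E1_meas that by simp
    show "indep_vars (\<lambda>_. borel) (\<lambda>(l, t). e l t) ({0..L} \<times> UNIV)" by (rule E1_indep)
    show "(\<integral>\<^sup>+\<omega>. ennreal ((norm (e l \<tau> \<omega>))\<^sup>2) \<partial>M) \<le> ennreal K" if "l \<le> L" for l \<tau>
      unfolding K_def using that E1_meas KE
      by (intro second_moment_le_of_higher_moment[OF prob _ \<delta>_pos]) auto
    show "norm (C l j *v x) \<le> b * \<rho> ^ j * norm x" if "l \<le> L" for l j x
      using norm_matrix_vector_mult_le[OF KC[OF that, of j], of x] by (simp add: b_def mult.assoc)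
    show "\<bar>vec_nth (H A) i - vec_nth (H B) i\<bar> \<le> \<bar>LH\<bar> * norm (A - B)" for A B
      by (rule order_trans[OF LH mult_right_mono]) auto
  qed (use \<rho> KC0 in \<open>auto simp: b_def K_def\<close>)
  interpret lipschitz_ma M L m lag \<phi> dd r s C e H \<nu> b \<rho> K "\<bar>LH\<bar>" by (rule ma)
  let ?H = "\<lambda>t \<omega>. H (\<chi> k. Uf (int t - int (lag k)) (s t) \<omega>)"
  have noise: "vec_nth (err t \<omega>) \<nu> = noise t \<omega>" if t: "t \<ge> 1" for t \<omega>
  proof -
    \<comment> \<open>The Bochner integral of a non-integrable function is 0 by convention, so a
      coordinate may be pulled out only once every coordinate is known to be integrable.\<close>
    have "integrable M (?H t)"
    proof (rule integrable_componentwise)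
      fix i
      show "integrable M (\<lambda>\<omega>. vec_nth (?H t \<omega>) i)"
        using lipschitz_ma.resp_integrable[where \<phi> = \<phi>, OF ma[of i] t]
        by (simp add: lipschitz_ma.resp_def[OF ma[of i], abs_def] Uf_def)
    qed
    then have "vec_nth (integral\<^sup>L M (?H t)) \<nu> = expectation (\<lambda>\<omega>. vec_nth (?H t \<omega>) \<nu>)"
      by (rule integral_bounded_linear[OF bounded_linear_vec_nth, symmetric])
    then show ?thesis
      by (simp add: err_def err_proc_def noise_def resp_def[abs_def] Uf_def)
  qed
  \<comment> \<open>Free of \<open>T\<close> and \<open>p T\<close>: the bounds on the regressors,
    the spectrum and the innovations are uniform.\<close>
  define D where "D = 2 * B\<^sup>2 * var_bound * (\<Sum>h. \<rho> ^ (h - m)) / (a * \<epsilon>)\<^sup>2"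
  let ?P = "\<lambda>T. measure M {\<omega> \<in> space M.
      vnorm (ols (X T) (X T *\<^sub>v \<beta> T + Matrix.vec T (\<lambda>t. vec_nth (err (t + 1) \<omega>) \<nu>)) - \<beta> T) > \<epsilon>}"
  have le: "?P T \<le> D * (real (p T) / real T)" if T: "T \<ge> 1" for T
    unfolding D_def noise[OF le_add2]
    by (rule ols_deviation_le[OF _ _ T B[OF T] a \<epsilon> eig[OF T]]) (use X_dim \<beta>_dim T in auto)
  show "?P \<longlonglongrightarrow> 0"
  proof (rule Lim_null_comparison)
    show "eventually (\<lambda>T. norm (?P T) \<le> D * (real (p T) / real T)) sequentially"
      using eventually_ge_at_top[of 1] by eventually_elim (use le in simp)
    show "(\<lambda>T. D * (real (p T) / real T)) \<longlonglongrightarrow> 0"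
      using tendsto_mult_left[OF dimension_ratio_tendsto_0[OF rate1 rate2], of D] by simp
  qed
qed

end
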